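(* Let $K$ be an algebraically closed field of characteristic $0$, let $V$ be a $K$-vector space of dimension $n+1$, and let $k$ be an integer with $3\le k\le \lfloor (n+1)/2\rfloor$. Then the chordal variety (secant line variety) $[\nu_k(G_{k,n+1})]^2\subseteq\mathbb{P}(\wedge^kV)$ has the expected dimension, i.e. $$\dim [\nu_k(G_{k,n+1})]^2=\min\left\{\binom{n+1}{k}-1,\ 2k(n+1-k)+1\right\}.$$
   Context: $G_{k,n+1}$ is the Grassmannian of $k$-dimensional linear subspaces of $V\simeq K^{n+1}$, and $\nu_k:G_{k,n+1}\to \mathbb{P}(\wedge^kV)\simeq\mathbb{P}^{N_k}$, $N_k=\binom{n+1}{k}-1$, is the Plücker embedding $\langle v_1,\dots,v_k\rangle\mapsto [v_1\wedge\cdots\wedge v_k]$; its image has dimension $k(n+1-k)$. For a closed irreducible projective variety $X\subseteq\mathbb{P}^N$, the $s$-th (higher) secant variety $X^s$ is the closure of the union of all linear spaces spanned by $s$ points of $X$. Its expected dimension is $\min\{N,\ s\dim X+s-1\}$. The chordal variety is $X^2$. *)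

theory Defs
  imports
    "HOL-Analysis.Abstract_Topology"
    "HOL-Computational_Algebra.Polynomial"
    "HOL-Library.Extended_Nat"
begin

section \<open>Dimension of a topological space\<close>

definition irreducible_in :: "'p topology \<Rightarrow> 'p set \<Rightarrow> bool" where
  "irreducible_in T Z \<longleftrightarrow> Z \<subseteq> topspace T \<and> Z \<noteq> {} \<and>
     (\<forall>A B. closedin T A \<and> closedin T B \<and> Z \<subseteq> A \<union> B \<longrightarrow> Z \<subseteq> A \<or> Z \<subseteq> B)"

text \<open>
  Krull dimension: the supremum of the lengths \<open>d\<close> of strictly increasing chains
  \<open>Z 0 \<subset> \<dots> \<subset> Z d\<close> of irreducible closed subsets.  (For the empty space, which has no such
  chains, the value is \<open>0\<close>.)
\<close>

definition krull_dim :: "'p topology \<Rightarrow> enat" where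
  "krull_dim T = Sup {enat d | d. \<exists>Z :: nat \<Rightarrow> 'p set.
     (\<forall>i\<le>d. closedin T (Z i) \<and> irreducible_in T (Z i)) \<and> (\<forall>i<d. Z i \<subset> Z (Suc i))}"


section \<open>The projective space of a vector space\<close>

locale projective_space = vector_space scale
  for scale :: "'a::field \<Rightarrow> 'b::ab_group_add \<Rightarrow> 'b" (infixr \<open>*s\<close> 75)
begin

text \<open>A point of the projective space is a line through the origin.\<close>

definition proj_space :: "'b set set" where
  "proj_space = {span {x} | x. x \<noteq> 0}"

text \<open>
  Homogeneous polynomial functions of degree \<open>d\<close>, without reference to a basis: the linear span of
  the products of \<open>d\<close> linear functionals.
\<close>

inductive hom_poly :: "nat \<Rightarrow> ('b \<Rightarrow> 'a) \<Rightarrow> bool" where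
  hom_poly_const: "hom_poly 0 (\<lambda>_. c)"
| hom_poly_zero: "hom_poly d (\<lambda>_. 0)"
| hom_poly_add: "hom_poly d p \<Longrightarrow> hom_poly d q \<Longrightarrow> hom_poly d (\<lambda>x. p x + q x)"
| hom_poly_linear_mult:
    "Vector_Spaces.linear scale (*) f \<Longrightarrow> hom_poly d p \<Longrightarrow> hom_poly (Suc d) (\<lambda>x. f x * p x)"

definition zero_locus :: "('b \<Rightarrow> 'a) set \<Rightarrow> 'b set set" where
  "zero_locus F = {L \<in> proj_space. \<forall>f\<in>F. \<forall>x\<in>L. f x = 0}"

definition proj_closed :: "'b set set \<Rightarrow> bool" where
  "proj_closed Z \<longleftrightarrow> (\<exists>F. (\<forall>f\<in>F. \<exists>d. hom_poly d f) \<and> Z = zero_locus F)"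

definition zariski :: "'b set topology" where
  "zariski = topology (\<lambda>U. U \<subseteq> proj_space \<and> proj_closed (proj_space - U))"

text \<open>The projective linear subspace spanned by a set of points.\<close>

definition proj_span :: "'b set set \<Rightarrow> 'b set set" where
  "proj_span S = {L \<in> proj_space. L \<subseteq> span (\<Union>S)}"

text \<open>The \<open>s\<close>-th secant variety \<open>X\<^sup>s\<close>; the chordal variety is the case \<open>s = 2\<close>.\<close>

definition secant_variety :: "nat \<Rightarrow> 'b set set \<Rightarrow> 'b set set" where
  "secant_variety s X =
     zariski closure_of (\<Union>{proj_span S | S. S \<subseteq> X \<and> finite S \<and> card S = s})"

definition proj_dim :: "'b set set \<Rightarrow> enat" where
  "proj_dim X = krull_dim (subtopology zariski X)"

text \<open>The Zariski-closed sets do form a topology.\<close>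

lemma hom_poly_mult:
  assumes "hom_poly d p" "hom_poly e q"
  shows "hom_poly (d + e) (\<lambda>x. p x * q x)"
proof -
  have cm: "hom_poly m (\<lambda>x. c * r x)" if "hom_poly m r" for m r c
    using that
  proof induction
    case (hom_poly_linear_mult f d p)
    then show ?case
      using hom_poly.hom_poly_linear_mult[of f d "\<lambda>x. c * p x"] by (simp add: mult.left_commute)
  qed (auto simp: distrib_left intro: hom_poly.intros)
  show ?thesis
    using assms
  proof (induction d p)
    case (hom_poly_linear_mult f d p)
    then show ?case
      using hom_poly.hom_poly_linear_mult[of f "d + e" "\<lambda>x. p x * q x"] by (simp add: mult.assoc)
  qed (auto simp: distrib_right intro: hom_poly.intros cm)
qed

lemma hom_poly_scale:
  assumes "hom_poly d p" shows "p (c *s x) = c ^ d * p x"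
  using assms
proof induction
  case (hom_poly_linear_mult f d p)
  then have "f (c *s x) = c * f x" by (simp add: Vector_Spaces.linear_iff)
  with hom_poly_linear_mult show ?case by (simp add: mult_ac)
qed (auto simp: distrib_left)

lemma istopology_zariski: "istopology (\<lambda>U. U \<subseteq> proj_space \<and> proj_closed (proj_space - U))"
  unfolding istopology_def
proof (safe)
  fix U U' assume "proj_closed (proj_space - U)" "proj_closed (proj_space - U')"
  then obtain F F' where F: "\<forall>f\<in>F. \<exists>d. hom_poly d f" "proj_space - U = zero_locus F"
    and F': "\<forall>f\<in>F'. \<exists>d. hom_poly d f" "proj_space - U' = zero_locus F'"
    unfolding proj_closed_def by metis
  let ?G = "{\<lambda>x. f x * g x | f g. f \<in> F \<and> g \<in> F'}"
  have "L \<in> zero_locus F \<or> L \<in> zero_locus F'" if L: "L \<in> zero_locus ?G" for L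
  proof (rule ccontr)
    assume neg: "\<not> (L \<in> zero_locus F \<or> L \<in> zero_locus F')"
    obtain y where y: "L = span {y}" "L \<in> proj_space"
      using L unfolding zero_locus_def proj_space_def by blast
    from neg y obtain f g a b where fg: "f \<in> F" "a \<in> L" "f a \<noteq> 0" "g \<in> F'" "b \<in> L" "g b \<noteq> 0"
      unfolding zero_locus_def by blast
    obtain c c' where "a = c *s y" "b = c' *s y"
      using fg y by (auto simp: span_singleton)
    moreover obtain d e where "hom_poly d f" "hom_poly e g" using F F' fg by blast
    ultimately have "f y \<noteq> 0" "g y \<noteq> 0"
      using fg(3,6) by (auto simp: hom_poly_scale[of d f] hom_poly_scale[of e g])
    moreover have "y \<in> L" using y by (simp add: span_base)
    then have "f y * g y = 0" using L fg unfolding zero_locus_def by fastforce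
    ultimately show False by simp
  qed
  moreover have "L \<in> zero_locus ?G" if "L \<in> zero_locus F \<or> L \<in> zero_locus F'" for L
    using that unfolding zero_locus_def by auto
  ultimately have "proj_space - U \<inter> U' = zero_locus ?G"
    using F(2) F'(2) by blast
  moreover have "\<forall>f\<in>?G. \<exists>d. hom_poly d f" using F(1) F'(1) hom_poly_mult by blast
  ultimately show "proj_closed (proj_space - U \<inter> U')" unfolding proj_closed_def by blast
next
  fix \<K> assume K: "\<forall>U\<in>\<K>. U \<subseteq> proj_space \<and> proj_closed (proj_space - U)"
  then have "\<forall>U\<in>\<K>. \<exists>F. (\<forall>f\<in>F. \<exists>d. hom_poly d f) \<and> proj_space - U = zero_locus F"
    unfolding proj_closed_def by blast
  then obtain F where F: "\<forall>U\<in>\<K>. (\<forall>f\<in>F U. \<exists>d. hom_poly d f) \<and> proj_space - U = zero_locus (F U)"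
    by metis
  have "proj_space - \<Union>\<K> = zero_locus (\<Union>U\<in>\<K>. F U)"
  proof (intro set_eqI iffI)
    fix L assume "L \<in> proj_space - \<Union>\<K>"
    then have "L \<in> proj_space" "\<forall>U\<in>\<K>. L \<in> zero_locus (F U)" using F by auto
    then show "L \<in> zero_locus (\<Union>U\<in>\<K>. F U)" unfolding zero_locus_def by blast
  next
    fix L assume "L \<in> zero_locus (\<Union>U\<in>\<K>. F U)"
    then have "L \<in> proj_space" "\<forall>U\<in>\<K>. L \<in> zero_locus (F U)" unfolding zero_locus_def by auto
    then show "L \<in> proj_space - \<Union>\<K>" using F by blast
  qed
  moreover have "\<forall>f\<in>(\<Union>U\<in>\<K>. F U). \<exists>d. hom_poly d f" using F by simp
  ultimately show "proj_closed (proj_space - \<Union>\<K>)" unfolding proj_closed_def by metis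
qed blast+

lemma openin_zariski:
  "openin zariski U \<longleftrightarrow> U \<subseteq> proj_space \<and> proj_closed (proj_space - U)"
  unfolding zariski_def by (simp add: istopology_zariski)

lemma topspace_zariski: "topspace zariski = proj_space"
proof -
  have "hom_poly 0 (\<lambda>_. 1)" by (rule hom_poly_const)
  moreover have "zero_locus {\<lambda>_. 1} = {}"
    unfolding zero_locus_def proj_space_def by (auto intro: span_zero)
  ultimately have "proj_closed {}"
    unfolding proj_closed_def by (intro exI[of _ "{\<lambda>_. 1}"]) auto
  then have "openin zariski proj_space" by (simp add: openin_zariski)
  then show ?thesis using openin_subset openin_zariski openin_topspace by (metis subset_antisym)
qed

lemma closedin_zariski: "closedin zariski Z \<longleftrightarrow> proj_closed Z"
proof -
  have "proj_closed Z \<Longrightarrow> Z \<subseteq> proj_space"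
    unfolding proj_closed_def zero_locus_def by blast
  then show ?thesis
    by (auto simp: closedin_def openin_zariski topspace_zariski double_diff)
qed

end


section \<open>Exterior powers and the Pluecker embedding\<close>

text \<open>Alternating \<open>k\<close>-linear maps; \<open>k\<close>-tuples are lists of length \<open>k\<close>.\<close>

definition alternating ::
  "('a::field \<Rightarrow> 'v::ab_group_add \<Rightarrow> 'v) \<Rightarrow> ('a \<Rightarrow> 'u::ab_group_add \<Rightarrow> 'u) \<Rightarrow> nat \<Rightarrow>
   ('v list \<Rightarrow> 'u) \<Rightarrow> bool" where
  "alternating sV sU k f \<longleftrightarrow>
     (\<forall>vs i. length vs = k \<and> i < k \<longrightarrow> Vector_Spaces.linear sV sU (\<lambda>x. f (vs[i := x]))) \<and>
     (\<forall>vs. length vs = k \<and> \<not> distinct vs \<longrightarrow> f vs = 0)"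

text \<open>
  The space \<open>W\<close> together with \<open>wedge [v\<^sub>1,\<dots>,v\<^sub>k] = v\<^sub>1 \<and> \<dots> \<and> v\<^sub>k\<close> is the \<open>k\<close>-th exterior power of
  \<open>V\<close>, described by its universal property.  The property is required for alternating maps into the
  ground field only, because an assumption cannot range over all target types; the lemma
  \<open>universal_property\<close> below derives it for an arbitrary target space.
\<close>

locale exterior_power =
  V: vector_space scaleV + W: vector_space scaleW
  for scaleV :: "'a::field \<Rightarrow> 'v::ab_group_add \<Rightarrow> 'v"
    and scaleW :: "'a \<Rightarrow> 'w::ab_group_add \<Rightarrow> 'w"
    and k :: nat
    and wedge :: "'v list \<Rightarrow> 'w" +
  assumes alternating_wedge: "alternating scaleV scaleW k wedge"
    and universal_form: "alternating scaleV (*) k f \<Longrightarrow>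
      \<exists>!g. Vector_Spaces.linear scaleW (*) g \<and> (\<forall>vs. length vs = k \<longrightarrow> g (wedge vs) = f vs)"
begin

definition grassmannian :: "'v set set" where
  "grassmannian = {U. V.subspace U \<and> V.dim U = k}"

definition basis_of :: "'v list \<Rightarrow> 'v set \<Rightarrow> bool" where
  "basis_of vs U \<longleftrightarrow> distinct vs \<and> V.independent (set vs) \<and> V.span (set vs) = U"

text \<open>Independent of the choice of basis: see \<open>plucker_eq\<close> below.\<close>

definition plucker :: "'v set \<Rightarrow> 'w set" where
  "plucker U = W.span {wedge (SOME vs. basis_of vs U)}"

lemma universal_property:
  fixes scaleU :: "'a \<Rightarrow> 'u::ab_group_add \<Rightarrow> 'u"
  assumes U: "vector_space scaleU" and f: "alternating scaleV scaleU k f"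
  shows "\<exists>!g. Vector_Spaces.linear scaleW scaleU g \<and> (\<forall>vs. length vs = k \<longrightarrow> g (wedge vs) = f vs)"
proof -
  interpret U: vector_space scaleU by fact
  interpret K: vector_space "(*) :: 'a \<Rightarrow> 'a \<Rightarrow> 'a"
    by unfold_locales (simp_all add: algebra_simps)
  interpret WU: vector_space_pair scaleW scaleU ..
  interpret WK: vector_space_pair scaleW "(*) :: 'a \<Rightarrow> 'a \<Rightarrow> 'a" ..
  interpret UK: vector_space_pair scaleU "(*) :: 'a \<Rightarrow> 'a \<Rightarrow> 'a" ..
  let ?D = "wedge ` {vs. length vs = k}"
  have zero_alt: "alternating scaleV (*) k (\<lambda>_. 0)"
    unfolding alternating_def
    by (simp add: Vector_Spaces.linear_iff V.vector_space_axioms K.vector_space_axioms)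
  have lin_zero: "Vector_Spaces.linear scaleW (*) (\<lambda>_. 0 :: 'a)"
    by (simp add: Vector_Spaces.linear_iff W.vector_space_axioms K.vector_space_axioms)
  have spanD: "W.span ?D = UNIV"
  proof (rule ccontr)
    assume "W.span ?D \<noteq> UNIV"
    then obtain w where w: "w \<notin> W.span ?D" by blast
    obtain B where B: "B \<subseteq> ?D" "W.independent B" "?D \<subseteq> W.span B"
      by (meson W.maximal_independent_subset)
    have spanB: "W.span B = W.span ?D"
      using B by (metis W.span_mono W.span_span subset_antisym)
    then have ind: "W.independent (insert w B)"
      using B w by (simp add: W.independent_insert)
    obtain g where g: "Vector_Spaces.linear scaleW (*) g"
        "\<forall>x\<in>insert w B. g x = (if x = w then 1 else (0::'a))"
      using WK.linear_independent_extend[OF ind, of "\<lambda>x. if x = w then 1 else 0"] by blast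
    have wB: "w \<notin> B" using w spanB W.span_base by blast
    have "g x = 0" if "x \<in> W.span B" for x
      by (rule WK.linear_eq_on[OF g(1) lin_zero that]) (use g(2) wB in auto)
    then have "\<forall>vs. length vs = k \<longrightarrow> g (wedge vs) = 0"
      using B(3) by blast
    with g(1) lin_zero universal_form[OF zero_alt] have "g = (\<lambda>_. 0)" by blast
    then show False using g(2) by auto
  qed
  obtain B where B: "B \<subseteq> ?D" "W.independent B" "?D \<subseteq> W.span B"
    by (meson W.maximal_independent_subset)
  have spanB: "W.span B = UNIV"
    using B spanD by (metis W.span_mono W.span_span top.extremum_uniqueI)
  have "\<forall>b\<in>B. \<exists>vs. length vs = k \<and> wedge vs = b" using B(1) by auto
  then obtain r where r: "\<And>b. b \<in> B \<Longrightarrow> length (r b) = k \<and> wedge (r b) = b" by metis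
  obtain g where g: "Vector_Spaces.linear scaleW scaleU g" "\<forall>b\<in>B. g b = f (r b)"
    using WU.linear_independent_extend[OF B(2), of "\<lambda>b. f (r b)"] by blast
  have sep: "x = 0" if "\<And>l. Vector_Spaces.linear scaleU (*) l \<Longrightarrow> l x = (0::'a)" for x
  proof (rule ccontr)
    assume "x \<noteq> 0"
    then have "U.independent {x}" by (simp add: U.dependent_single)
    then obtain l where "Vector_Spaces.linear scaleU (*) l" "\<forall>y\<in>{x}. l y = (1::'a)"
      using UK.linear_independent_extend[of "{x}" "\<lambda>_. 1"] by blast
    with that[of l] show False by simp
  qed
  have "g (wedge vs) = f vs" if vs: "length vs = k" for vs
  proof -
    have "g (wedge vs) - f vs = 0"
    proof (rule sep)
      fix l :: "'u \<Rightarrow> 'a" assume l: "Vector_Spaces.linear scaleU (*) l"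
      have "alternating scaleV (*) k (\<lambda>vs. l (f vs))"
        using f l unfolding alternating_def Vector_Spaces.linear_iff
        by (auto intro: V.vector_space_axioms K.vector_space_axioms) (metis U.scale_zero_left mult_zero_left)
      then obtain h where h: "Vector_Spaces.linear scaleW (*) h"
          "\<And>vs. length vs = k \<Longrightarrow> h (wedge vs) = l (f vs)"
        using universal_form by blast
      have lg: "Vector_Spaces.linear scaleW (*) (\<lambda>x. l (g x))"
        using g(1) l by (simp add: Vector_Spaces.linear_iff)
      have "l (g x) = h x" for x
        by (rule WK.linear_eq_on[OF lg h(1), of _ B]) (use spanB g(2) r h(2) in \<open>auto, metis\<close>)
      then have "l (g (wedge vs)) = l (f vs)" using h(2) vs by metis
      then show "l (g (wedge vs) - f vs) = 0"
        using l by (metis Modules.module_hom.diff Vector_Spaces.linear_iff_module_hom diff_self)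
    qed
    then show ?thesis by simp
  qed
  moreover have "g' = g" if g': "Vector_Spaces.linear scaleW scaleU g'"
    "\<forall>vs. length vs = k \<longrightarrow> g' (wedge vs) = f vs" for g'
  proof
    fix x show "g' x = g x"
      by (rule WU.linear_eq_on[OF g'(1) g(1), of _ B]) (use spanB g(2) r g'(2) in \<open>auto, metis\<close>)
  qed
  ultimately show ?thesis using g(1) by blast
qed

lemma wedge_linear:
  assumes "length vs = k" "i < k"
  shows "Vector_Spaces.linear scaleV scaleW (\<lambda>x. wedge (vs[i := x]))"
  using assms alternating_wedge unfolding alternating_def by blast

lemma wedge_not_distinct:
  assumes "length vs = k" "\<not> distinct vs"
  shows "wedge vs = 0"
  using assms alternating_wedge unfolding alternating_def by blast

lemma wedge_swap:
  assumes vs: "length vs = k" and ij: "i < k" "j < k" "i \<noteq> j"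
  shows "wedge (vs[i := x, j := y]) = - wedge (vs[i := y, j := x])"
proof -
  have zero: "wedge (vs[i := z, j := z]) = 0" for z
  proof (rule wedge_not_distinct)
    have "vs[i := z, j := z] ! i = vs[i := z, j := z] ! j" using vs ij by simp
    then show "\<not> distinct (vs[i := z, j := z])"
      using vs ij by (metis length_list_update nth_eq_iff_index_eq)
  qed (use vs in simp)
  have addj: "wedge (us[j := a + b]) = wedge (us[j := a]) + wedge (us[j := b])"
    if "length us = k" for us a b
    using wedge_linear[OF that ij(2)] by (simp add: Vector_Spaces.linear_iff)
  have addi: "wedge (vs[i := a + b, j := c]) = wedge (vs[i := a, j := c]) + wedge (vs[i := b, j := c])"
    for a b c
  proof -
    have "length (vs[j := c]) = k" using vs by simp
    from wedge_linear[OF this ij(1)] show ?thesis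
      using ij(3) by (simp add: Vector_Spaces.linear_iff list_update_swap)
  qed
  have "0 = wedge (vs[i := x + y, j := x + y])" by (simp add: zero)
  also have "\<dots> = wedge (vs[i := x, j := y]) + wedge (vs[i := y, j := x])"
    using vs zero[of x] zero[of y] by (simp add: addi addj)
  finally show ?thesis by (metis add_eq_0_iff2)
qed

lemma wedge_permuted:
  assumes us: "distinct us" "length us = k"
    and n: "n \<le> k" and vs: "distinct vs" "length vs = k" "set vs = set us"
    and agree: "\<And>i. n \<le> i \<Longrightarrow> i < k \<Longrightarrow> vs ! i = us ! i"
  shows "wedge vs \<in> W.span {wedge us}"
  using n vs agree
proof (induction n arbitrary: vs)
  case 0
  then have "vs = us" using us by (intro nth_equalityI) auto
  then show ?case by (simp add: W.span_base)
next
  case (Suc n)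
  have nk: "n < k" using Suc.prems by simp
  have "us ! n \<in> set vs" using Suc.prems us nk by (metis nth_mem)
  then obtain j where j: "j < k" "vs ! j = us ! n" using Suc.prems by (metis in_set_conv_nth)
  have jn: "j \<le> n"
  proof (rule ccontr)
    assume "\<not> j \<le> n"
    then have "vs ! j = us ! j" using Suc.prems j by simp
    then show False using j us nk \<open>\<not> j \<le> n\<close> by (metis nth_eq_iff_index_eq order_refl)
  qed
  show ?case
  proof (cases "j = n")
    case True
    then have "vs ! i = us ! i" if "n \<le> i" "i < k" for i
      using Suc.prems j that by (cases "i = n") auto
    then show ?thesis using Suc nk by simp
  next
    case False
    let ?ws = "vs[j := vs ! n, n := vs ! j]"
    have ws: "distinct ?ws" "length ?ws = k" "set ?ws = set us"
      using Suc.prems nk j(1) distinct_swap[of j vs n] set_swap[of j vs n] by simp_all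
    have "?ws ! i = us ! i" if "n \<le> i" "i < k" for i
      using Suc.prems j that jn False by (cases "i = n") auto
    then have "wedge ?ws \<in> W.span {wedge us}" using Suc.IH ws nk by simp
    moreover have "wedge vs = - wedge ?ws"
      using wedge_swap[of vs j n "vs ! j" "vs ! n"] Suc.prems(3) j(1) nk False
      by (metis list_update_id)
    ultimately show ?thesis by (simp add: W.span_neg)
  qed
qed

lemma wedge_in_span:
  assumes us: "distinct us" "length us = k"
    and n: "n \<le> k" and vs: "length vs = k" "set vs \<subseteq> V.span (set us)"
    and later: "\<And>i. n \<le> i \<Longrightarrow> i < k \<Longrightarrow> vs ! i \<in> set us"
  shows "wedge vs \<in> W.span {wedge us}"
  using n vs later
proof (induction n arbitrary: vs)
  case 0
  then have sub: "set vs \<subseteq> set us" by (auto simp: in_set_conv_nth)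
  show ?case
  proof (cases "distinct vs")
    case True
    then have "set vs = set us"
      using 0 us sub by (intro card_subset_eq) (auto simp: distinct_card)
    then show ?thesis using wedge_permuted[of us k vs] True 0 us by simp
  next
    case False
    then show ?thesis using wedge_not_distinct 0 by (simp add: W.span_zero)
  qed
next
  case (Suc n)
  have nk: "n < k" using Suc.prems by simp
  have lin: "Vector_Spaces.linear scaleV scaleW (\<lambda>x. wedge (vs[n := x]))"
    using wedge_linear Suc.prems nk by blast
  have "wedge (vs[n := x]) \<in> W.span {wedge us}" if "x \<in> V.span (set us)" for x
    using that
  proof (induction rule: V.span_induct)
    case base
    show ?case
      using lin unfolding V.subspace_def Vector_Spaces.linear_iff
      by (auto simp: W.span_add W.span_scale)
        (metis V.scale_zero_left W.scale_zero_left W.span_zero)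
  next
    case (step x)
    show ?case
    proof (rule Suc.IH)
      show "set (vs[n := x]) \<subseteq> V.span (set us)"
        using set_update_subset_insert[of vs n x] Suc.prems(3) step V.span_base by blast
      show "vs[n := x] ! i \<in> set us" if "n \<le> i" "i < k" for i
        using that Suc.prems step by (cases "i = n") auto
    qed (use Suc.prems nk in auto)
  qed
  moreover have "vs ! n \<in> V.span (set us)" using Suc.prems(2,3) nk by (metis nth_mem subsetD)
  ultimately show ?case by (metis list_update_id)
qed

lemma plucker_eq:
  assumes us: "basis_of us U" and k: "length us = k"
  shows "plucker U = W.span {wedge us}"
proof -
  define vs where "vs = (SOME vs. basis_of vs U)"
  have vs: "basis_of vs U" unfolding vs_def using us by (rule someI)
  have len: "length ws = V.dim U" if "basis_of ws U" for ws
    using that unfolding basis_of_def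
    by (metis V.dim_eq_card V.span_span distinct_card)
  have kvs: "length vs = k" using len us vs k by metis
  have "wedge vs \<in> W.span {wedge us}"
    by (rule wedge_in_span[of us k]) (use us vs k kvs V.span_superset in \<open>auto simp: basis_of_def\<close>)
  moreover have "wedge us \<in> W.span {wedge vs}"
    by (rule wedge_in_span[of vs k]) (use us vs k kvs V.span_superset in \<open>auto simp: basis_of_def\<close>)
  ultimately have "W.span {wedge vs} = W.span {wedge us}"
    by (meson W.span_minimal W.subspace_span empty_subsetI insert_subset subset_antisym)
  then show ?thesis unfolding plucker_def vs_def .
qed

end

end

theory Submission
  imports Defs "HOL-Combinatorics.Permutations"
begin

text \<open>
  Write \<open>dim V = k + l\<close>, so that \<open>3 \<le> k \<le> l\<close>.  A secant line is given by two points of the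
  Grassmannian, with \<open>k l\<close> affine coordinates each, and a point on the line; so the chordal variety
  is the closure of finitely many images of affine spaces of dimension \<open>2 k l + 1\<close>, one for each
  pair of charts.  It has exactly this dimension because near two transversal subspaces the
  parameters can be recovered from Pluecker coordinates.  Let \<open>I\<close> and \<open>I'\<close> be disjoint
  sets of \<open>k\<close> basis vectors.  The tangent space of the cone over the Grassmannian at \<open>e\<^sub>I\<close> is spanned
  by the \<open>e\<^sub>J\<close> for which \<open>J\<close> has at least \<open>k - 1\<close> elements in \<open>I\<close>.  No \<open>J\<close> has at least \<open>k - 1\<close>
  elements in both \<open>I\<close> and \<open>I'\<close>, since \<open>2 (k - 1) > k\<close>; so the tangent spaces at \<open>e\<^sub>I\<close> and \<open>e\<^sub>I\<^sub>'\<close> are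
  linearly disjoint, as in Terracini's lemma.  In particular \<open>2 (k l + 1) \<le> (k + l choose k)\<close>, and
  the minimum in the theorem is always its second term.

  Krull dimension is compared with the number of parameters through Hilbert functions:
  \<open>hilbert_ge Z d N\<close> says that at least \<open>N\<close> forms of degree \<open>d\<close> are linearly independent on \<open>Z\<close>.
  In a chain \<open>Z 0 \<subset> \<dots> \<subset> Z m\<close> of irreducible closed sets every step raises the order of growth,
  because multiplication by a form that vanishes on \<open>Z i\<close> but not on \<open>Z (Suc i)\<close> is injective on
  \<open>Z (Suc i)\<close>; by induction the Hilbert function of \<open>Z m\<close> grows at least like \<open>r ^ m\<close>
  (\<open>hilbert_ge_chain\<close>).  On the other hand a form of degree \<open>d\<close> pulls back along a polynomial map to
  a polynomial of degree proportional to \<open>d\<close>, so on a set that is covered by finitely many images of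
  \<open>m\<close> parameters the growth is at most that of \<open>d ^ m\<close> (\<open>hilbert_ge_parametrized\<close>).  This gives the
  upper bound \<open>proj_dim_le\<close>.

  For the lower bound \<open>proj_dim_ge\<close> the parameters are switched on one by one, which gives an
  increasing sequence of closures of images of affine spaces; these are irreducible.  They
  increase strictly if with \<open>i\<close> parameters the Hilbert function really grows like \<open>d ^ i\<close>.  That is
  shown by restriction to a monomial curve \<open>y\<^sub>p = t ^ w\<^sub>p\<close> in the parameter space: by the
  linear disjointness above, suitable linear forms have orders exactly \<open>w\<^sub>p\<close> along the curve
  (\<open>local_coordinate\<close>), and the \<open>w\<^sub>p\<close> are chosen such that distinct monomials in these forms vanish to
  distinct orders and are therefore independent (\<open>hilbert_ge_flag\<close>).
\<close>

section \<open>Polynomial functions of finitely many parameters\<close>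

text \<open>
  The bound \<open>d\<close> is on the degree in each variable separately: the monomials are then indexed by
  \<open>{..<m} \<rightarrow>\<^sub>E {..d}\<close>, which has \<open>(d + 1) ^ m\<close> elements.
\<close>

inductive poly_fun :: "nat \<Rightarrow> nat \<Rightarrow> ((nat \<Rightarrow> 'a::field) \<Rightarrow> 'a) \<Rightarrow> bool" for m where
  poly_fun_zero: "poly_fun m d (\<lambda>_. 0)"
| poly_fun_add: "poly_fun m d p \<Longrightarrow> poly_fun m d q \<Longrightarrow> poly_fun m d (\<lambda>y. p y + q y)"
| poly_fun_monomial: "\<forall>j<m. e j \<le> d \<Longrightarrow> poly_fun m d (\<lambda>y. c * (\<Prod>j<m. y j ^ e j))"

lemma poly_fun_const: "poly_fun m d (\<lambda>_. c)"
  using poly_fun_monomial[of m "\<lambda>_. 0" d c] by simp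

lemma poly_fun_var:
  assumes "i < m" shows "poly_fun m (Suc d) (\<lambda>y :: nat \<Rightarrow> 'a::field. y i)"
proof -
  have "(\<Prod>j<m. y j ^ (if j = i then 1 else 0)) = y i" for y :: "nat \<Rightarrow> 'a"
    using assms by (simp add: if_distrib[of "\<lambda>n. _ ^ n"] prod.delta cong: if_cong)
  moreover have "poly_fun m (Suc d) (\<lambda>y :: nat \<Rightarrow> 'a. 1 * (\<Prod>j<m. y j ^ (if j = i then 1 else 0)))"
    by (rule poly_fun_monomial) simp
  ultimately show ?thesis by simp
qed

lemma poly_fun_mono: "poly_fun m d p \<Longrightarrow> d \<le> d' \<Longrightarrow> poly_fun m d' p"
  by (induction rule: poly_fun.induct) (auto intro!: poly_fun.intros dest: order_trans)

lemma poly_fun_sum: "(\<And>i. i \<in> I \<Longrightarrow> poly_fun m d (p i)) \<Longrightarrow> poly_fun m d (\<lambda>y. \<Sum>i\<in>I. p i y)"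
  by (induction I rule: infinite_finite_induct) (auto intro: poly_fun_const poly_fun_add)

lemma poly_fun_mult:
  assumes "poly_fun m d p" "poly_fun m d' q"
  shows "poly_fun m (d + d') (\<lambda>y. p y * q y)"
  using assms
proof (induction d p)
  case (poly_fun_monomial e d c)
  from poly_fun_monomial(2,1) show ?case
  proof (induction d' q)
    case (poly_fun_monomial e' d' c')
    then have "poly_fun m (d + d') (\<lambda>y. (c * c') * (\<Prod>j<m. y j ^ (e j + e' j)))"
      by (intro poly_fun.poly_fun_monomial) (auto intro: add_mono)
    then show ?case by (simp add: power_add prod.distrib mult_ac)
  qed (auto simp: distrib_left intro: poly_fun.intros)
qed (auto simp: distrib_right intro: poly_fun.intros)

lemma poly_fun_monomial_expansion:
  assumes "poly_fun m d p"
  shows "\<exists>a. \<forall>y. p y = (\<Sum>e\<in>{..<m} \<rightarrow>\<^sub>E {..d}. a e * (\<Prod>j<m. y j ^ e j))"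
  using assms
proof (induction rule: poly_fun.induct)
  case (poly_fun_zero d)
  show ?case by (rule exI[of _ "\<lambda>_. 0"]) simp
next
  case (poly_fun_add d p q)
  then obtain a b where "\<forall>y. p y = (\<Sum>e\<in>{..<m} \<rightarrow>\<^sub>E {..d}. a e * (\<Prod>j<m. y j ^ e j))"
    "\<forall>y. q y = (\<Sum>e\<in>{..<m} \<rightarrow>\<^sub>E {..d}. b e * (\<Prod>j<m. y j ^ e j))" by blast
  then show ?case
    by (intro exI[of _ "\<lambda>e. a e + b e"]) (simp add: sum.distrib distrib_right)
next
  case (poly_fun_monomial e d c)
  let ?e = "restrict e {..<m}"
  have "?e \<in> {..<m} \<rightarrow>\<^sub>E {..d}" using poly_fun_monomial by auto
  then show ?case
    by (intro exI[of _ "\<lambda>f. if f = ?e then c else 0"])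
      (simp add: if_distrib[of "\<lambda>x. x * _"] finite_PiE cong: if_cong)
qed

lemma poly_fun_on_line:
  assumes "poly_fun m d p"
  shows "\<exists>r. \<forall>t. p (\<lambda>j. a j + t * b j) = poly r t"
  using assms
proof (induction rule: poly_fun.induct)
  case (poly_fun_zero d)
  show ?case by (rule exI[of _ 0]) simp
next
  case (poly_fun_add d p q)
  then obtain r s where "\<forall>t. p (\<lambda>j. a j + t * b j) = poly r t"
    "\<forall>t. q (\<lambda>j. a j + t * b j) = poly s t" by blast
  then show ?case by (intro exI[of _ "r + s"]) simp
next
  case (poly_fun_monomial e d c)
  show ?case
    by (intro exI[of _ "[:c:] * (\<Prod>j<m. [:a j, b j:] ^ e j)"]) (simp add: poly_prod)
qed

text \<open>
  On the line through \<open>y\<close> and \<open>z\<close> both functions become nonzero polynomials in one variable, and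
  these have only finitely many zeros.  This is what makes images of affine spaces irreducible.
\<close>

lemma poly_fun_common_nonzero:
  fixes p q :: "(nat \<Rightarrow> 'a::field_char_0) \<Rightarrow> 'a"
  assumes "poly_fun m d p" "poly_fun m d' q" "p y \<noteq> 0" "q z \<noteq> 0"
  shows "\<exists>x. p x \<noteq> 0 \<and> q x \<noteq> 0"
proof -
  obtain r where r: "\<And>t. p (\<lambda>j. y j + t * (z j - y j)) = poly r t"
    using poly_fun_on_line[OF assms(1), of y "\<lambda>j. z j - y j"] by blast
  obtain s where s: "\<And>t. q (\<lambda>j. y j + t * (z j - y j)) = poly s t"
    using poly_fun_on_line[OF assms(2), of y "\<lambda>j. z j - y j"] by blast
  have "r \<noteq> 0" "s \<noteq> 0" using r[of 0] s[of 1] assms(3,4) by auto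
  then have "finite {t. poly (r * s) t = 0}" by (intro poly_roots_finite) simp
  then obtain t where "poly (r * s) t \<noteq> 0"
    using infinite_UNIV_char_0[where 'a = 'a] by (metis (mono_tags, lifting) UNIV_eq_I mem_Collect_eq)
  then show ?thesis using r[of t] s[of t]
    by (intro exI[of _ "\<lambda>j. y j + t * (z j - y j)"]) simp
qed

text \<open>
  Gaussian elimination: the equation \<open>e\<close> expresses one unknown \<open>i0\<close> by the others, which leaves one
  equation and one unknown fewer.
\<close>

lemma underdetermined_system:
  fixes A :: "'i \<Rightarrow> 'e \<Rightarrow> 'a::field"
  assumes "finite E" "finite I" "card E < card I"
  shows "\<exists>c. (\<exists>i\<in>I. c i \<noteq> 0) \<and> (\<forall>e\<in>E. (\<Sum>i\<in>I. c i * A i e) = 0)"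
  using assms
proof (induction E arbitrary: I A rule: finite_induct)
  case empty
  then have "I \<noteq> {}" by auto
  then show ?case by (intro exI[of _ "\<lambda>_. 1"]) auto
next
  case (insert e E)
  show ?case
  proof (cases "\<forall>i\<in>I. A i e = 0")
    case True
    have "card E < card I" using insert by simp
    then obtain c where "\<exists>i\<in>I. c i \<noteq> 0" "\<forall>e\<in>E. (\<Sum>i\<in>I. c i * A i e) = 0"
      using insert.IH insert.prems(1) by blast
    with True show ?thesis by (intro exI[of _ c]) simp
  next
    case False
    then obtain i0 where i0: "i0 \<in> I" "A i0 e \<noteq> 0" by blast
    define J where "J = I - {i0}"
    have J: "finite J" "card E < card J" "i0 \<notin> J" "I = insert i0 J"
      using insert i0 by (auto simp: J_def)
    obtain c where c: "\<exists>i\<in>J. c i \<noteq> 0"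
        "\<forall>e'\<in>E. (\<Sum>i\<in>J. c i * (A i e' - A i e / A i0 e * A i0 e')) = 0"
      using insert.IH[OF J(1,2), of "\<lambda>i e'. A i e' - A i e / A i0 e * A i0 e'"] by blast
    define c' where "c' = c(i0 := - (\<Sum>i\<in>J. c i * A i e) / A i0 e)"
    have sumI: "(\<Sum>i\<in>I. c' i * A i e') = c' i0 * A i0 e' + (\<Sum>i\<in>J. c i * A i e')" for e'
      using J by (auto simp: c'_def intro!: sum.cong)
    have "(\<Sum>i\<in>I. c' i * A i e') = 0" if "e' \<in> E" for e'
    proof -
      have "0 = (\<Sum>i\<in>J. c i * A i e') - (\<Sum>i\<in>J. c i * A i e) * (A i0 e' / A i0 e)"
        using c(2) that by (simp add: sum_distrib_right right_diff_distrib sum_subtractf sum_divide_distrib mult.assoc)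
      then show ?thesis
        unfolding sumI by (simp add: c'_def)
    qed
    moreover have "(\<Sum>i\<in>I. c' i * A i e) = 0" using i0 unfolding sumI by (simp add: c'_def)
    moreover have "\<exists>i\<in>I. c' i \<noteq> 0" using c(1) J by (auto simp: c'_def)
    ultimately show ?thesis by blast
  qed
qed

section \<open>Hilbert functions\<close>

context projective_space
begin

text \<open>
  The Hilbert function of \<open>Z\<close> in degree \<open>d\<close> is at least \<open>N\<close>.  Only such lower bounds occur, so
  quotients of spaces of forms and their dimensions can be avoided.
\<close>

definition hilbert_ge :: "'b set set \<Rightarrow> nat \<Rightarrow> nat \<Rightarrow> bool" where
  "hilbert_ge Z d N \<longleftrightarrow> (\<exists>g. (\<forall>i<N. hom_poly d (g i)) \<and>
     (\<forall>c. (\<forall>x\<in>\<Union>Z. (\<Sum>i<N. c i * g i x) = 0) \<longrightarrow> (\<forall>i<N. c i = 0)))"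

lemma hom_poly_cmult: "hom_poly d f \<Longrightarrow> hom_poly d (\<lambda>x. c * f x)"
  using hom_poly_mult[OF hom_poly_const[of c], of d f] by simp

lemma hom_poly_sum: "(\<And>i. i \<in> I \<Longrightarrow> hom_poly d (p i)) \<Longrightarrow> hom_poly d (\<lambda>x. \<Sum>i\<in>I. p i x)"
  by (induction I rule: infinite_finite_induct) (auto intro: hom_poly.intros)

lemma hom_poly_power: "hom_poly d f \<Longrightarrow> hom_poly (d * r) (\<lambda>x. f x ^ r)"
proof (induction r)
  case 0
  show ?case by (simp add: hom_poly_const)
next
  case (Suc r)
  then show ?case using hom_poly_mult[of d f "d * r" "\<lambda>x. f x ^ r"] by simp
qed

lemma hom_poly_prod:
  "(\<And>i. i < n \<Longrightarrow> hom_poly (d i) (p i)) \<Longrightarrow> hom_poly (\<Sum>i<n. d i) (\<lambda>x. \<Prod>i<n. p i x)" for n :: nat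
proof (induction n)
  case 0
  show ?case by (simp add: hom_poly_const)
next
  case (Suc n)
  then have "hom_poly ((\<Sum>i<n. d i) + d n) (\<lambda>x. (\<Prod>i<n. p i x) * p n x)"
    by (intro hom_poly_mult) auto
  then show ?case by simp
qed

lemma hom_poly_linear: "Vector_Spaces.linear scale (*) f \<Longrightarrow> hom_poly 1 f"
  using hom_poly_linear_mult[OF _ hom_poly_const[of 1], of f] by simp

lemma functional_nonzero:
  assumes "x \<noteq> 0"
  obtains l where "Vector_Spaces.linear scale (*) l" "l x \<noteq> 0"
proof -
  interpret K: vector_space "(*) :: 'a \<Rightarrow> 'a \<Rightarrow> 'a"
    by unfold_locales (simp_all add: algebra_simps)
  interpret vector_space_pair scale "(*) :: 'a \<Rightarrow> 'a \<Rightarrow> 'a" ..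
  have "independent {x}" using assms by (simp add: dependent_single)
  then obtain l where "Vector_Spaces.linear scale (*) l" "\<forall>y\<in>{x}. l y = (1::'a)"
    using linear_independent_extend[of "{x}" "\<lambda>_. 1"] by blast
  then show ?thesis using that by simp
qed

lemma closedin_zero_locus: "hom_poly d f \<Longrightarrow> closedin zariski (zero_locus {f})"
  unfolding closedin_zariski proj_closed_def by blast

lemma vanishing_on_closure:
  assumes "hom_poly d f" "U \<subseteq> proj_space" "\<And>x. x \<in> \<Union>U \<Longrightarrow> f x = 0" "x \<in> \<Union>(zariski closure_of U)"
  shows "f x = 0"
proof -
  have "U \<subseteq> zero_locus {f}" using assms(2,3) by (auto simp: zero_locus_def)
  then have "zariski closure_of U \<subseteq> zero_locus {f}"
    using closedin_zero_locus[OF assms(1)] by (rule closure_of_minimal)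
  then show ?thesis using assms(4) by (auto simp: zero_locus_def)
qed

lemma hilbert_ge_closure:
  assumes "hilbert_ge (zariski closure_of U) d N" "U \<subseteq> proj_space"
  shows "hilbert_ge U d N"
proof -
  obtain g where g: "\<forall>i<N. hom_poly d (g i)"
    "\<And>c. (\<forall>x\<in>\<Union>(zariski closure_of U). (\<Sum>i<N. c i * g i x) = 0) \<Longrightarrow> (\<forall>i<N. c i = 0)"
    using assms(1) unfolding hilbert_ge_def by blast
  have "hom_poly d (\<lambda>x. \<Sum>i<N. c i * g i x)" for c
    using g(1) by (intro hom_poly_sum hom_poly_cmult) auto
  then have "\<forall>x\<in>\<Union>(zariski closure_of U). (\<Sum>i<N. c i * g i x) = 0"
    if "\<forall>x\<in>\<Union>U. (\<Sum>i<N. c i * g i x) = 0" for c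
    using that vanishing_on_closure[where f = "\<lambda>x. \<Sum>i<N. c i * g i x", OF _ assms(2)] by blast
  then have "\<forall>i<N. c i = 0" if "\<forall>x\<in>\<Union>U. (\<Sum>i<N. c i * g i x) = 0" for c
    using that g(2) by simp
  then show ?thesis using g(1) unfolding hilbert_ge_def by (intro exI[of _ g]) simp
qed

lemma hilbert_ge_mono: "hilbert_ge Z d N \<Longrightarrow> Z \<subseteq> Z' \<Longrightarrow> hilbert_ge Z' d N"
  unfolding hilbert_ge_def
proof (elim exE conjE)
  fix g assume "Z \<subseteq> Z'" "\<forall>i<N. hom_poly d (g i)"
    and g: "\<forall>c. (\<forall>x\<in>\<Union>Z. (\<Sum>i<N. c i * g i x) = 0) \<longrightarrow> (\<forall>i<N. c i = 0)"
  moreover have "\<forall>i<N. c i = 0" if "\<forall>x\<in>\<Union>Z'. (\<Sum>i<N. c i * g i x) = 0" for c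
    by (rule g[THEN spec, THEN mp]) (use that \<open>Z \<subseteq> Z'\<close> in auto)
  ultimately show "\<exists>g. (\<forall>i<N. hom_poly d (g i)) \<and>
      (\<forall>c. (\<forall>x\<in>\<Union>Z'. (\<Sum>i<N. c i * g i x) = 0) \<longrightarrow> (\<forall>i<N. c i = 0))"
    by (intro exI[of _ g]) simp
qed

text \<open>
  The coordinate ring of an irreducible set is a domain.  The product vanishes at each vector of \<open>\<Union>Z\<close>
  separately; by homogeneity one of the factors then vanishes on the whole line through that vector.
\<close>

lemma irreducible_in_product:
  assumes irr: "irreducible_in (subtopology zariski Y) Z"
    and fg: "hom_poly d f" "hom_poly e g"
    and zero: "\<And>x. x \<in> \<Union>Z \<Longrightarrow> f x * g x = 0"
  shows "(\<forall>x\<in>\<Union>Z. f x = 0) \<or> (\<forall>x\<in>\<Union>Z. g x = 0)"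
proof -
  have Z: "Z \<subseteq> proj_space" "Z \<subseteq> Y"
    using irr by (auto simp: irreducible_in_def topspace_zariski)
  have "L \<in> zero_locus {f} \<or> L \<in> zero_locus {g}" if L: "L \<in> Z" for L
  proof (rule ccontr)
    assume "\<not> ?thesis"
    moreover have "L \<in> proj_space" using L Z by blast
    ultimately obtain a b where ab: "a \<in> L" "f a \<noteq> 0" "b \<in> L" "g b \<noteq> 0"
      unfolding zero_locus_def by blast
    obtain y where y: "L = span {y}"
      using L Z unfolding proj_space_def by blast
    obtain c c' where "a = c *s y" "b = c' *s y"
      using ab y by (auto simp: span_singleton)
    then have "f y \<noteq> 0" "g y \<noteq> 0"
      using ab fg by (auto simp: hom_poly_scale[of d f] hom_poly_scale[of e g])
    moreover have "y \<in> \<Union>Z" using y L by (auto intro: span_base)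
    ultimately show False using zero by force
  qed
  then have "Z \<subseteq> (zero_locus {f} \<inter> Y) \<union> (zero_locus {g} \<inter> Y)" using Z by blast
  moreover have "closedin (subtopology zariski Y) (zero_locus {f} \<inter> Y)"
      "closedin (subtopology zariski Y) (zero_locus {g} \<inter> Y)"
    using fg closedin_zero_locus by (auto simp: closedin_subtopology)
  ultimately have "Z \<subseteq> zero_locus {f} \<inter> Y \<or> Z \<subseteq> zero_locus {g} \<inter> Y"
    using irr unfolding irreducible_in_def by blast
  then show ?thesis by (auto simp: zero_locus_def)
qed

text \<open>
  Multiplication by \<open>f\<close> embeds the forms of degree \<open>d\<close> on \<open>Z'\<close> into the forms of degree \<open>d + e\<close>, and its
  image restricts to zero on \<open>Z\<close>.  Independent forms on \<open>Z\<close> therefore remain independent of this image.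
\<close>

lemma hilbert_ge_step:
  assumes irr: "irreducible_in (subtopology zariski Y) Z'" and sub: "Z \<subseteq> Z'"
    and f: "hom_poly e f" "\<And>x. x \<in> \<Union>Z \<Longrightarrow> f x = 0" "\<exists>x\<in>\<Union>Z'. f x \<noteq> 0"
    and Z: "hilbert_ge Z (d + e) M" and Z': "hilbert_ge Z' d N"
  shows "hilbert_ge Z' (d + e) (M + N)"
proof -
  obtain g where g: "\<forall>i<M. hom_poly (d + e) (g i)"
    "\<And>c. (\<forall>x\<in>\<Union>Z. (\<Sum>i<M. c i * g i x) = 0) \<Longrightarrow> (\<forall>i<M. c i = 0)"
    using Z unfolding hilbert_ge_def by blast
  obtain h where h: "\<forall>i<N. hom_poly d (h i)"
    "\<And>c. (\<forall>x\<in>\<Union>Z'. (\<Sum>i<N. c i * h i x) = 0) \<Longrightarrow> (\<forall>i<N. c i = 0)"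
    using Z' unfolding hilbert_ge_def by blast
  define p where "p i = (if i < M then g i else (\<lambda>x. h (i - M) x * f x))" for i
  have split: "(\<Sum>i<M+N. c i * p i x) = (\<Sum>i<M. c i * g i x) + (\<Sum>i<N. c (M + i) * h i x) * f x" for c x
  proof -
    have "(\<Sum>i<M+N. c i * p i x) = (\<Sum>i<M. c i * p i x) + (\<Sum>i<N. c (M + i) * p (M + i) x)"
      by (induction N) (auto simp: add.assoc)
    then show ?thesis by (simp add: p_def sum_distrib_right mult.assoc)
  qed
  have "c i = 0" if z: "\<forall>x\<in>\<Union>Z'. (\<Sum>i<M+N. c i * p i x) = 0" and i: "i < M + N" for c i
  proof -
    have cM: "\<forall>i<M. c i = 0"
    proof (rule g(2), rule ballI)
      fix x assume x: "x \<in> \<Union>Z"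
      then have "(\<Sum>i<M+N. c i * p i x) = 0" using z sub by blast
      then show "(\<Sum>i<M. c i * g i x) = 0" using split f(2)[OF x] by simp
    qed
    have "hom_poly d (\<lambda>x. \<Sum>i<N. c (M + i) * h i x)"
      using h(1) by (intro hom_poly_sum hom_poly_cmult) auto
    moreover have "(\<Sum>i<N. c (M + i) * h i x) * f x = 0" if "x \<in> \<Union>Z'" for x
      using z[rule_format, OF that] split[of c x] cM by simp
    ultimately have "\<forall>x\<in>\<Union>Z'. (\<Sum>i<N. c (M + i) * h i x) = 0"
      using irreducible_in_product[OF irr _ f(1), of d "\<lambda>x. \<Sum>i<N. c (M + i) * h i x"] f(3) by blast
    then have "\<forall>i<N. c (M + i) = 0" by (rule h(2))
    then show ?thesis using cM i by (metis add_diff_inverse_nat nat_add_left_cancel_less)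
  qed
  moreover have "\<forall>i<M+N. hom_poly (d + e) (p i)"
    using g(1) h(1) f(1) by (auto simp: p_def intro!: hom_poly_mult)
  ultimately show ?thesis unfolding hilbert_ge_def by blast
qed

lemma separating_hom_poly:
  assumes "closedin (subtopology zariski Y) Z" "Z' \<subseteq> Y" "Z' \<subseteq> proj_space" "\<not> Z' \<subseteq> Z"
  obtains d f where "hom_poly d f" "\<And>x. x \<in> \<Union>Z \<Longrightarrow> f x = 0" "\<exists>x\<in>\<Union>Z'. f x \<noteq> 0"
proof -
  obtain T where T: "closedin zariski T" "Z = T \<inter> Y"
    using assms(1) by (auto simp: closedin_subtopology)
  then obtain F where F: "\<forall>f\<in>F. \<exists>d. hom_poly d f" "T = zero_locus F"
    unfolding closedin_zariski proj_closed_def by blast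
  obtain L where L: "L \<in> Z'" "L \<notin> Z" using assms(4) by blast
  then have "L \<notin> zero_locus F" "L \<in> proj_space" using T F assms by auto
  then obtain f x where f: "f \<in> F" "x \<in> L" "f x \<noteq> 0" unfolding zero_locus_def by blast
  moreover obtain d where "hom_poly d f" using F f by blast
  moreover have "f x = 0" if "x \<in> \<Union>Z" for x
    using that T F f(1) unfolding zero_locus_def by blast
  ultimately show ?thesis using that L by blast
qed

lemma hilbert_ge_one:
  assumes "Z \<noteq> {}" "Z \<subseteq> proj_space"
  shows "hilbert_ge Z d 1"
proof -
  obtain x where x: "x \<noteq> 0" "span {x} \<in> Z" using assms unfolding proj_space_def by blast
  obtain l where l: "Vector_Spaces.linear scale (*) l" "l x \<noteq> 0" using functional_nonzero x by blast
  have "hom_poly d (\<lambda>x. l x ^ d)" using hom_poly_power[OF hom_poly_linear[OF l(1)], of d] by simp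
  moreover have "x \<in> \<Union>Z" using x by (auto intro: span_base)
  ultimately show ?thesis
    unfolding hilbert_ge_def using l by (intro exI[of _ "\<lambda>_ x. l x ^ d"]) auto
qed

text \<open>
  Replacing the separating forms by powers, all of them have the same degree \<open>e\<close>.  With
  \<open>h i r\<close> for the value at \<open>r * e\<close> of the Hilbert function of \<open>Z i\<close>, \<open>hilbert_ge_step\<close> gives
  \<open>h (i + 1) (r + 1) \<ge> h i (r + 1) + h (i + 1) r\<close>, which is Pascal's rule for \<open>r + i choose i\<close>.
\<close>

lemma hilbert_ge_chain:
  assumes closed: "\<And>i. i \<le> m \<Longrightarrow> closedin (subtopology zariski Y) (Z i)"
    and irr: "\<And>i. i \<le> m \<Longrightarrow> irreducible_in (subtopology zariski Y) (Z i)"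
    and strict: "\<And>i. i < m \<Longrightarrow> Z i \<subset> Z (Suc i)"
  shows "\<exists>e>0. \<forall>r. hilbert_ge (Z m) (r * e) ((r + m) choose m)"
proof -
  have sub: "Z i \<subseteq> Y" "Z i \<subseteq> proj_space" "Z i \<noteq> {}" if "i \<le> m" for i
    using irr[OF that] by (auto simp: irreducible_in_def topspace_zariski)
  have "\<exists>d f. hom_poly d f \<and> (\<forall>x\<in>\<Union>(Z i). f x = 0) \<and> (\<exists>x\<in>\<Union>(Z (Suc i)). f x \<noteq> 0)"
    if "i < m" for i
    using separating_hom_poly[OF closed, of i "Z (Suc i)"] sub[of "Suc i"] strict[OF that] that
    by (metis Suc_leI less_imp_le not_less psubset_eq subset_antisym)
  then obtain d f where f: "\<And>i. i < m \<Longrightarrow> hom_poly (d i) (f i)"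
      "\<And>i x. i < m \<Longrightarrow> x \<in> \<Union>(Z i) \<Longrightarrow> f i x = 0"
      "\<And>i. i < m \<Longrightarrow> \<exists>x\<in>\<Union>(Z (Suc i)). f i x \<noteq> 0"
    by metis
  \<comment> \<open>A form of degree \<open>0\<close> is constant, so it cannot vanish on the nonempty \<open>Z i\<close> and not on \<open>Z (Suc i)\<close>.\<close>
  have dpos: "d i > 0" if i: "i < m" for i
  proof (rule ccontr)
    assume "\<not> d i > 0"
    then have hp: "hom_poly 0 (f i)" using f(1)[OF i] by simp
    have "f i x = f i (0 *s x)" for x using hom_poly_scale[OF hp, of 0 x] by simp
    then have const: "f i x = f i 0" for x by (simp add: scale_zero_left)
    obtain L where L: "L \<in> Z i" using sub(3)[of i] i by force
    then obtain x where "x \<in> L" using sub(2)[of i] i unfolding proj_space_def by (auto intro: span_zero)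
    then have "f i 0 = 0" using f(2)[OF i] L const by (metis UnionI)
    then show False using f(3)[OF i] const by metis
  qed
  define e where "e = (\<Prod>i<m. d i)"
  have e: "e > 0" unfolding e_def using dpos by (simp add: prod_pos)
  have "hilbert_ge (Z i) (r * e) ((r + i) choose i)" if "i \<le> m" for i r
    using that
  proof (induction i arbitrary: r)
    case 0
    show ?case using hilbert_ge_one[OF sub(3,2)[of 0]] by simp
  next
    case (Suc i)
    then have i: "i < m" by simp
    then have "d i dvd e" unfolding e_def by (intro dvd_prodI) auto
    then obtain b where b: "e = d i * b" by blast
    have bpos: "b > 0" using b e by (cases b) auto
    have F: "hom_poly e (\<lambda>x. f i x ^ b)" "\<And>x. x \<in> \<Union>(Z i) \<Longrightarrow> f i x ^ b = 0"
        "\<exists>x\<in>\<Union>(Z (Suc i)). f i x ^ b \<noteq> 0"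
      using hom_poly_power[OF f(1)[OF i], of b] f(2,3)[OF i] b bpos by auto
    show ?case
    proof (induction r)
      case 0
      show ?case using hilbert_ge_one[OF sub(3,2)[of "Suc i"]] Suc.prems by simp
    next
      case (Suc r)
      have "hilbert_ge (Z i) (r * e + e) ((Suc r + i) choose i)"
        using Suc.prems \<open>\<And>r. i \<le> m \<Longrightarrow> hilbert_ge (Z i) (r * e) ((r + i) choose i)\<close>[of "Suc r"] i
        by (simp add: add.commute)
      then have "hilbert_ge (Z (Suc i)) (r * e + e) (((Suc r + i) choose i) + ((r + Suc i) choose Suc i))"
        using hilbert_ge_step[OF irr _ F _ Suc.IH] i strict[OF i] by (meson Suc_leI psubset_imp_subset)
      then show ?case by (simp add: add.commute)
    qed
  qed
  then show ?thesis using e by blast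
qed

definition poly_map :: "nat \<Rightarrow> nat \<Rightarrow> ((nat \<Rightarrow> 'a) \<Rightarrow> 'b) \<Rightarrow> bool" where
  "poly_map m D \<phi> \<longleftrightarrow> (\<forall>l. Vector_Spaces.linear scale (*) l \<longrightarrow> poly_fun m D (\<lambda>y. l (\<phi> y)))"

lemma poly_fun_pullback:
  assumes "hom_poly d f" "poly_map m D \<phi>"
  shows "poly_fun m (D * d) (\<lambda>y. f (\<phi> y))"
  using assms
proof induction
  case (hom_poly_linear_mult f d p)
  then show ?case
    using poly_fun_mult[of m D "\<lambda>y. f (\<phi> y)" "D * d" "\<lambda>y. p (\<phi> y)"] by (simp add: poly_map_def)
qed (auto intro: poly_fun_const poly_fun_add)

text \<open>
  A form of degree \<open>d\<close> pulls back along each map to a combination of \<open>(D * d + 1) ^ m\<close> monomials,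
  and its values on the cone over \<open>Z\<close> are determined by these coefficients.  More forms than
  coefficients are linearly dependent.
\<close>

lemma hilbert_ge_parametrized:
  assumes Z: "hilbert_ge Z d N" and C: "finite C"
    and \<phi>: "\<And>c. c \<in> C \<Longrightarrow> poly_map m D (\<phi> c)"
    and cover: "\<And>x. x \<in> \<Union>Z \<Longrightarrow> \<exists>c\<in>C. \<exists>a y. x = a *s \<phi> c y"
  shows "N \<le> card C * (D * d + 1) ^ m"
proof (rule ccontr)
  assume "\<not> ?thesis"
  then have big: "card C * (D * d + 1) ^ m < N" by simp
  obtain g where g: "\<And>i. i < N \<Longrightarrow> hom_poly d (g i)"
    "\<And>c. (\<forall>x\<in>\<Union>Z. (\<Sum>i<N. c i * g i x) = 0) \<Longrightarrow> (\<forall>i<N. c i = 0)"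
    using Z unfolding hilbert_ge_def by blast
  let ?E = "{..<m} \<rightarrow>\<^sub>E {..D * d}"
  have "\<exists>a. \<forall>y. g i (\<phi> c y) = (\<Sum>e\<in>?E. a e * (\<Prod>j<m. y j ^ e j))" if "i < N" "c \<in> C" for i c
    by (intro poly_fun_monomial_expansion poly_fun_pullback g \<phi> that)
  then obtain a where a: "\<And>i c y. i < N \<Longrightarrow> c \<in> C \<Longrightarrow>
      g i (\<phi> c y) = (\<Sum>e\<in>?E. a i c e * (\<Prod>j<m. y j ^ e j))"
    by metis
  have "card (C \<times> ?E) < card {..<N}"
    using big by (simp add: card_cartesian_product card_PiE)
  moreover have "finite (C \<times> ?E)" using C by (simp add: finite_PiE)
  ultimately obtain u where u: "\<exists>i\<in>{..<N}. u i \<noteq> 0"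
      "\<forall>(c, e)\<in>C \<times> ?E. (\<Sum>i<N. u i * a i c e) = 0"
    using underdetermined_system[of "C \<times> ?E" "{..<N}" "\<lambda>i (c, e). a i c e"] by (auto simp: split_beta)
  have "(\<Sum>i<N. u i * g i x) = 0" if "x \<in> \<Union>Z" for x
  proof -
    obtain c b y where x: "c \<in> C" "x = b *s \<phi> c y" using cover \<open>x \<in> \<Union>Z\<close> by blast
    have "(\<Sum>i<N. u i * g i (\<phi> c y)) = (\<Sum>i<N. \<Sum>e\<in>?E. u i * a i c e * (\<Prod>j<m. y j ^ e j))"
      using a x by (simp add: sum_distrib_left mult.assoc)
    also have "\<dots> = (\<Sum>e\<in>?E. (\<Sum>i<N. u i * a i c e) * (\<Prod>j<m. y j ^ e j))"
      by (subst sum.swap) (simp add: sum_distrib_right)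
    also have "\<dots> = 0" using u(2) x by simp
    finally have "(\<Sum>i<N. u i * g i (\<phi> c y)) = 0" .
    moreover have "(\<Sum>i<N. u i * g i x) = b ^ d * (\<Sum>i<N. u i * g i (\<phi> c y))"
      using x by (simp add: hom_poly_scale[OF g(1)] sum_distrib_left mult.left_commute)
    ultimately show ?thesis by simp
  qed
  then show False using g(2)[of u] u(1) by auto
qed

end

section \<open>Bounds for the Krull dimension\<close>

text \<open>
  The left hand side is a polynomial of degree \<open>m\<close> in \<open>r\<close>, the right hand side one of degree \<open>M\<close>.  At
  \<open>r = m * (q - 1)\<close> the left hand side is at least \<open>q ^ m\<close>, and the right hand side is at most
  \<open>c * b ^ M * q ^ M\<close>; hence a contradiction if \<open>q\<close> exceeds \<open>c * b ^ M\<close> and \<open>M < m\<close>.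
\<close>

lemma binomial_polynomial_growth:
  assumes "\<And>r. (r + m choose m) \<le> c * (D * (r * e) + 1) ^ M"
  shows "m \<le> M"
proof (rule ccontr)
  assume "\<not> m \<le> M"
  then have m: "M < m" "0 < m" by auto
  define b where "b = D * m * e + 1"
  define q where "q = c * b ^ M + 1"
  have q: "q \<ge> 1" by (simp add: q_def)
  have "q ^ m \<le> (m * q choose m)"
  proof -
    have "m \<le> m * q" using q by simp
    from binomial_ge_n_over_k_pow_k[OF this, where 'a = rat]
    have "(of_nat q :: rat) ^ m \<le> of_nat (m * q choose m)" using m by simp
    then show ?thesis by (metis of_nat_le_iff of_nat_power)
  qed
  also have "\<dots> \<le> c * (D * (m * (q - 1) * e) + 1) ^ M"
    using assms[of "m * (q - 1)"] q by (simp add: algebra_simps)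
  also have "\<dots> \<le> c * (b * q) ^ M"
  proof -
    have "D * (m * (q - 1) * e) \<le> D * (m * q * e)" by (intro mult_le_mono) auto
    then have "D * (m * (q - 1) * e) + 1 \<le> b * q" using q by (simp add: b_def algebra_simps)
    then show ?thesis by (intro mult_le_mono power_mono) auto
  qed
  also have "\<dots> = (c * b ^ M) * q ^ M" by (simp add: power_mult_distrib)
  also have "\<dots> < q * q ^ M" using q by (intro mult_strict_right_mono) (auto simp: q_def)
  also have "\<dots> = q ^ Suc M" by simp
  also have "\<dots> \<le> q ^ m" using m q by (intro power_increasing) auto
  finally show False by simp
qed

context projective_space
begin

lemma proj_dim_le:
  assumes C: "finite C" and \<phi>: "\<And>c. c \<in> C \<Longrightarrow> poly_map m D (\<phi> c)"
    and U: "U \<subseteq> proj_space"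
    and cover: "\<And>x. x \<in> \<Union>U \<Longrightarrow> \<exists>c\<in>C. \<exists>a y. x = a *s \<phi> c y"
  shows "proj_dim (zariski closure_of U) \<le> enat m"
  unfolding proj_dim_def krull_dim_def
proof (rule Sup_least)
  let ?Y = "zariski closure_of U"
  fix n assume "n \<in> {enat d | d. \<exists>Z :: nat \<Rightarrow> 'b set set.
     (\<forall>i\<le>d. closedin (subtopology zariski ?Y) (Z i) \<and> irreducible_in (subtopology zariski ?Y) (Z i)) \<and>
     (\<forall>i<d. Z i \<subset> Z (Suc i))}"
  then obtain d and Z :: "nat \<Rightarrow> 'b set set" where n: "n = enat d"
    and Z: "\<And>i. i \<le> d \<Longrightarrow> closedin (subtopology zariski ?Y) (Z i)"
      "\<And>i. i \<le> d \<Longrightarrow> irreducible_in (subtopology zariski ?Y) (Z i)"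
      "\<And>i. i < d \<Longrightarrow> Z i \<subset> Z (Suc i)" by blast
  obtain e where e: "\<And>r. hilbert_ge (Z d) (r * e) ((r + d) choose d)"
    using hilbert_ge_chain[of d ?Y Z] Z by blast
  have "Z d \<subseteq> ?Y" using Z(1)[of d] closedin_subset by fastforce
  then have "hilbert_ge U (r * e) ((r + d) choose d)" for r
    using e hilbert_ge_mono hilbert_ge_closure[OF _ U] by blast
  then have "((r + d) choose d) \<le> card C * (D * (r * e) + 1) ^ m" for r
    by (rule hilbert_ge_parametrized[OF _ C \<phi> cover])
  then have "d \<le> m" by (rule binomial_polynomial_growth)
  then show "n \<le> enat m" using n by simp
qed

definition param_image :: "((nat \<Rightarrow> 'a) \<Rightarrow> 'b) \<Rightarrow> 'b set set" where
  "param_image \<phi> = {span {\<phi> y} | y. \<phi> y \<noteq> 0}"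

lemma param_image_subset: "param_image \<phi> \<subseteq> proj_space"
  unfolding param_image_def proj_space_def by blast

lemma in_param_image:
  assumes "x \<in> \<Union>(param_image \<phi>)" shows "\<exists>a y. x = a *s \<phi> y"
  using assms unfolding param_image_def by (auto simp: span_singleton)

end


locale projective_space_char_0 = projective_space scale
  for scale :: "'a::field_char_0 \<Rightarrow> 'b::ab_group_add \<Rightarrow> 'b" (infixr \<open>*s\<close> 75)
begin

text \<open>
  Pulled back to the parameters, a product of two forms is a product of polynomials, which vanishes
  only if a factor does.
\<close>

lemma irreducible_param_image:
  assumes \<phi>: "poly_map m D \<phi>" and ne: "param_image \<phi> \<noteq> {}" and Y: "param_image \<phi> \<subseteq> Y"
    and closed: "closedin zariski Y"
  shows "irreducible_in (subtopology zariski Y) (zariski closure_of (param_image \<phi>))"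
  unfolding irreducible_in_def
proof (intro conjI allI impI)
  let ?U = "param_image \<phi>"
  have UY: "zariski closure_of ?U \<subseteq> Y" using Y closed by (rule closure_of_minimal)
  then show "zariski closure_of ?U \<subseteq> topspace (subtopology zariski Y)"
    using closure_of_subset_topspace[of zariski ?U] by (simp add: topspace_subtopology)
  have U: "?U \<subseteq> zariski closure_of ?U"
    by (rule closure_of_subset) (simp add: topspace_zariski param_image_subset)
  then show "zariski closure_of ?U \<noteq> {}" using ne by blast
  fix A B assume AB: "closedin (subtopology zariski Y) A \<and> closedin (subtopology zariski Y) B \<and>
    zariski closure_of ?U \<subseteq> A \<union> B"
  have nonzero: "\<exists>d f y. hom_poly d f \<and> (\<forall>x\<in>\<Union>T. f x = 0) \<and> \<phi> y \<noteq> 0 \<and> f (\<phi> y) \<noteq> 0"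
    if T: "closedin (subtopology zariski Y) T" "\<not> zariski closure_of ?U \<subseteq> T" for T
  proof -
    have "closedin zariski T"
      using T(1) closed by (metis closedin_trans_full)
    then have "\<not> ?U \<subseteq> T" using T(2) closure_of_minimal by metis
    then obtain d f where f: "hom_poly d f" "\<And>x. x \<in> \<Union>T \<Longrightarrow> f x = 0" "\<exists>x\<in>\<Union>?U. f x \<noteq> 0"
      using separating_hom_poly[OF T(1) Y param_image_subset] by metis
    then obtain y x where y: "\<phi> y \<noteq> 0" "x \<in> span {\<phi> y}" "f x \<noteq> 0"
      unfolding param_image_def by blast
    then obtain a where "x = a *s \<phi> y" by (auto simp: span_singleton)
    then have "f (\<phi> y) \<noteq> 0" using y(3) by (auto simp: hom_poly_scale[OF f(1)])
    then show ?thesis using f y(1) by blast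
  qed
  show "zariski closure_of ?U \<subseteq> A \<or> zariski closure_of ?U \<subseteq> B"
  proof (rule ccontr)
    assume neg: "\<not> ?thesis"
    obtain d f y where f: "hom_poly d f" "\<And>x. x \<in> \<Union>A \<Longrightarrow> f x = 0" "\<phi> y \<noteq> 0" "f (\<phi> y) \<noteq> 0"
      using nonzero[of A] AB neg by blast
    obtain e g z where g: "hom_poly e g" "\<And>x. x \<in> \<Union>B \<Longrightarrow> g x = 0" "\<phi> z \<noteq> 0" "g (\<phi> z) \<noteq> 0"
      using nonzero[of B] AB neg by blast
    \<comment> \<open>The extra factor \<open>l\<close> forces \<open>\<phi> u\<close> to be nonzero, so that it spans a point of the image; forms of
      degree \<open>0\<close> alone would not.\<close>
    obtain l where l: "Vector_Spaces.linear scale (*) l" "l (\<phi> y) \<noteq> 0"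
      using functional_nonzero f(3) by blast
    have lf: "hom_poly (Suc d) (\<lambda>x. l x * f x)" using l f by (intro hom_poly_linear_mult)
    obtain u where u: "l (\<phi> u) * f (\<phi> u) \<noteq> 0" "g (\<phi> u) \<noteq> 0"
      using poly_fun_common_nonzero[OF poly_fun_pullback[OF lf \<phi>] poly_fun_pullback[OF g(1) \<phi>], of y z]
        f(4) g(4) l(2) by auto
    have "l 0 = l (0 *s 0)" by simp
    also have "\<dots> = 0" using l(1) unfolding Vector_Spaces.linear_iff by (metis mult_zero_left)
    finally have "\<phi> u \<noteq> 0" using u(1) by auto
    then have "span {\<phi> u} \<in> ?U" unfolding param_image_def by blast
    then have "span {\<phi> u} \<in> A \<union> B" using U AB by blast
    moreover have "\<phi> u \<in> span {\<phi> u}" by (simp add: span_base)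
    ultimately have "f (\<phi> u) = 0 \<or> g (\<phi> u) = 0" using f(2) g(2) by blast
    then show False using u by auto
  qed
qed

text \<open>
  The closures of the images form a chain of irreducible closed sets.  If two consecutive ones were
  equal, a set with \<open>i\<close> parameters would have a Hilbert function that grows like \<open>d ^ (i + 1)\<close>, which
  \<open>hilbert_ge_parametrized\<close> excludes.
\<close>

lemma proj_dim_ge:
  assumes \<phi>: "\<And>i. i \<le> m \<Longrightarrow> poly_map i D (\<phi> i)"
    and incl: "\<And>i. i < m \<Longrightarrow> param_image (\<phi> i) \<subseteq> param_image (\<phi> (Suc i))"
    and hilbert: "\<And>i q. i \<le> m \<Longrightarrow> q \<ge> 2 \<Longrightarrow> hilbert_ge (param_image (\<phi> i)) (i * q) (q ^ i)"
    and Y: "closedin zariski Y" "param_image (\<phi> m) \<subseteq> Y"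
  shows "enat m \<le> proj_dim Y"
  unfolding proj_dim_def krull_dim_def
proof (rule Sup_upper, intro CollectI exI conjI allI impI)
  let ?Z = "\<lambda>i. zariski closure_of (param_image (\<phi> i))"
  have sub: "param_image (\<phi> i) \<subseteq> Y" if "i \<le> m" for i
    using that
  proof (induction "m - i" arbitrary: i)
    case 0
    then show ?case using Y by simp
  next
    case (Suc n)
    then have "param_image (\<phi> (Suc i)) \<subseteq> Y" by (intro Suc.hyps) auto
    moreover have "i < m" using Suc by simp
    ultimately show ?case using incl by blast
  qed
  show "enat m = enat m" ..
  show "irreducible_in (subtopology zariski Y) (?Z i)" if i: "i \<le> m" for i
  proof (rule irreducible_param_image[OF \<phi>[OF i] _ sub[OF i] Y(1)])
    have "hilbert_ge (param_image (\<phi> i)) (i * 2) (2 ^ i)" using hilbert i by simp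
    then show "param_image (\<phi> i) \<noteq> {}"
      unfolding hilbert_ge_def by (auto dest!: spec[of _ "\<lambda>_. 1"] spec[of _ 0])
  qed
  show "closedin (subtopology zariski Y) (?Z i)" if i: "i \<le> m" for i
    using closure_of_minimal[OF sub[OF i] Y(1)] by (auto simp: closedin_closed_subtopology[OF Y(1)])
  show "?Z i \<subset> ?Z (Suc i)" if i: "i < m" for i
  proof
    show "?Z i \<subseteq> ?Z (Suc i)" by (rule closure_of_mono[OF incl[OF i]])
    show "?Z i \<noteq> ?Z (Suc i)"
    proof
      assume eq: "?Z i = ?Z (Suc i)"
      define b where "b = D * Suc i + 1"
      define q where "q = b ^ i + 2"
      have "hilbert_ge (param_image (\<phi> (Suc i))) (Suc i * q) (q ^ Suc i)"
        using hilbert[of "Suc i" q] i by (simp add: q_def)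
      then have "hilbert_ge (?Z (Suc i)) (Suc i * q) (q ^ Suc i)"
        by (rule hilbert_ge_mono) (simp add: closure_of_subset topspace_zariski param_image_subset)
      then have "hilbert_ge (param_image (\<phi> i)) (Suc i * q) (q ^ Suc i)"
        unfolding eq[symmetric] by (rule hilbert_ge_closure) (rule param_image_subset)
      then have "q ^ Suc i \<le> card {()} * (D * (Suc i * q) + 1) ^ i"
      proof (rule hilbert_ge_parametrized[where \<phi> = "\<lambda>_. \<phi> i"])
        show "\<exists>c\<in>{()}. \<exists>a y. x = a *s \<phi> i y" if "x \<in> \<Union>(param_image (\<phi> i))" for x
          using in_param_image[OF that] by simp
      qed (use \<phi> i in auto)
      also have "\<dots> = (D * (Suc i * q) + 1) ^ i" by simp
      also have "\<dots> \<le> (b * q) ^ i"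
        by (rule power_mono) (simp_all add: b_def q_def algebra_simps)
      also have "\<dots> = b ^ i * q ^ i" by (rule power_mult_distrib)
      also have "\<dots> < q * q ^ i" by (intro mult_strict_right_mono) (auto simp: q_def)
      finally show False by simp
    qed
  qed
qed

end

section \<open>Determinants\<close>

text \<open>
  The determinant of the \<open>k \<times> k\<close> matrix with entries \<open>G a r\<close>.  The entries will be scalars, and also
  polynomials in the parameter of a curve.
\<close>

definition leibniz :: "nat \<Rightarrow> (nat \<Rightarrow> nat \<Rightarrow> 'a::comm_ring_1) \<Rightarrow> 'a" where
  "leibniz k G = (\<Sum>p | p permutes {..<k}. of_int (sign p) * (\<Prod>r<k. G (p r) r))"

lemma leibniz_cong:
  assumes "\<And>a r. a < k \<Longrightarrow> r < k \<Longrightarrow> G a r = H a r"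
  shows "leibniz k G = leibniz k H"
  unfolding leibniz_def
proof (rule sum.cong)
  fix p assume "p \<in> {p. p permutes {..<k}}"
  then have "p r < k" if "r < k" for r using permutes_in_image that by fastforce
  then show "of_int (sign p) * (\<Prod>r<k. G (p r) r) = of_int (sign p) * (\<Prod>r<k. H (p r) r)"
    using assms by simp
qed simp

lemma poly_leibniz: "poly (leibniz k G) x = leibniz k (\<lambda>a r. poly (G a r) x)"
  by (simp add: leibniz_def poly_sum poly_prod)

text \<open>
  Composition with the transposition of \<open>a\<close> and \<open>b\<close> changes the sign of every summand, so the
  determinant equals its negative; the characteristic is not \<open>2\<close>.
\<close>

lemma leibniz_equal_columns:
  fixes G :: "nat \<Rightarrow> nat \<Rightarrow> 'a::field_char_0"
  assumes ab: "a < k" "b < k" "a \<noteq> b" and eq: "\<And>i. G i a = G i b"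
  shows "leibniz k G = 0"
proof -
  let ?s = "transpose a b"
  let ?f = "\<lambda>p. of_int (sign p) * (\<Prod>r<k. G (p r) r)"
  have s: "?s permutes {..<k}" using ab by (intro permutes_swap_id) auto
  have "leibniz k G = (\<Sum>p | p permutes {..<k}. ?f (p \<circ> ?s))"
    unfolding leibniz_def
    by (rule sum_permutations_compose_right[OF s])
  also have "\<dots> = (\<Sum>p | p permutes {..<k}. - ?f p)"
  proof (rule sum.cong)
    fix p assume "p \<in> {p. p permutes {..<k}}"
    then have p: "p permutes {..<k}" by simp
    then have sg: "sign (p \<circ> ?s) = - sign p"
      using ab s by (subst sign_compose) (auto simp: sign_swap_id permutation_permutes)
    have "(\<Prod>r<k. G ((p \<circ> ?s) r) r) = (\<Prod>r<k. G (p (?s r)) (?s r))"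
      by (rule prod.cong) (auto simp: transpose_def eq)
    also have "\<dots> = (\<Prod>r<k. G (p r) r)"
      using prod.permute[OF s, of "\<lambda>r. G (p r) r"] by (simp add: o_def)
    finally show "?f (p \<circ> ?s) = - ?f p" using sg by simp
  qed simp
  also have "\<dots> = - leibniz k G" by (simp add: leibniz_def sum_negf)
  finally show ?thesis by simp
qed

text \<open>
  A permutation other than the identity moves some \<open>t\<close> to a value other than \<open>i\<close>, because it moves at
  least two points; its summand then contains an off-diagonal entry of a unit row.
\<close>

lemma leibniz_unit_rows:
  assumes i: "i < k" and unit: "\<And>a r. a < k \<Longrightarrow> a \<noteq> i \<Longrightarrow> r < k \<Longrightarrow> G a r = (if a = r then 1 else 0)"
  shows "leibniz k G = G i i"
proof -
  have zero: "(\<Prod>r<k. G (p r) r) = 0" if p: "p permutes {..<k}" "p \<noteq> id" for p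
  proof -
    obtain r where r: "p r \<noteq> r" using p(2) by (auto simp: fun_eq_iff)
    then have rk: "r < k" using p(1) by (meson lessThan_iff permutes_not_in)
    obtain t where t: "t < k" "p t \<noteq> t" "p t \<noteq> i"
    proof (cases "p r = i")
      case False
      then show ?thesis using that r rk by blast
    next
      case True
      have "p (p r) \<noteq> p r" using r p(1) by (metis permutes_inj injD)
      then show ?thesis
        using that[of "p r"] True r rk p(1) by (metis i injD permutes_inj)
    qed
    then have "G (p t) t = 0" using unit[of "p t" t] p(1) permutes_in_image[OF p(1), of t] by simp
    then show ?thesis using t(1) by (intro prod_zero) auto
  qed
  have "leibniz k G = (\<Sum>p\<in>{id}. of_int (sign p) * (\<Prod>r<k. G (p r) r))"
    unfolding leibniz_def
    by (rule sum.mono_neutral_right) (auto simp: zero finite_permutations permutes_id)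
  also have "\<dots> = (\<Prod>r<k. G r r)" by simp
  also have "\<dots> = (\<Prod>r\<in>{i}. G r r)"
    by (rule prod.mono_neutral_right) (use i unit in auto)
  finally show ?thesis by simp
qed

text \<open>
  Each summand has one factor from every row, and only one of these rows is \<open>i\<close>.
\<close>

lemma dvd_leibniz:
  fixes G :: "nat \<Rightarrow> nat \<Rightarrow> 'a::comm_ring_1"
  assumes i: "i < k" and dvd: "\<And>a r. a < k \<Longrightarrow> a \<noteq> i \<Longrightarrow> r < k \<Longrightarrow> x dvd G a r"
  shows "x ^ (k - 1) dvd leibniz k G"
  unfolding leibniz_def
proof (intro dvd_sum dvd_mult)
  fix p assume "p \<in> {p. p permutes {..<k}}"
  then have p: "p permutes {..<k}" by simp
  define r0 where "r0 = inv p i"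
  have r0: "r0 < k" "p r0 = i"
    using permutes_in_image[OF permutes_inv[OF p], of i] i permutes_inverses[OF p] by (auto simp: r0_def)
  have "(\<Prod>r\<in>{..<k} - {r0}. x) dvd (\<Prod>r\<in>{..<k} - {r0}. G (p r) r)"
  proof (rule prod_dvd_prod)
    fix r assume r: "r \<in> {..<k} - {r0}"
    then have "p r \<noteq> i" using r0 p by (metis DiffE injD permutes_inj singletonI)
    moreover have "p r < k" using r permutes_in_image[OF p, of r] by simp
    ultimately show "x dvd G (p r) r" using dvd r by simp
  qed
  moreover have "(\<Prod>r\<in>{..<k} - {r0}. x) = x ^ (k - 1)" using r0 by simp
  moreover have "(\<Prod>r<k. G (p r) r) = G (p r0) r0 * (\<Prod>r\<in>{..<k} - {r0}. G (p r) r)"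
    using r0 by (subst prod.remove[of _ r0]) auto
  ultimately show "x ^ (k - 1) dvd (\<Prod>r<k. G (p r) r)" by simp
qed

section \<open>Orders of vanishing at the origin\<close>

text \<open>
  Near \<open>0\<close> the polynomial \<open>p\<close> behaves like the \<open>a\<close>-th power of the variable: its order of vanishing is
  \<open>a\<close>, and its lowest coefficient is \<open>1\<close>.
\<close>

definition monic_order :: "'a::field poly \<Rightarrow> nat \<Rightarrow> bool" where
  "monic_order p a \<longleftrightarrow> (\<exists>u. p = monom 1 a + monom 1 (Suc a) * u)"

lemma monic_order_mult:
  assumes "monic_order p a" "monic_order q b" shows "monic_order (p * q) (a + b)"
proof -
  obtain u v where p: "p = monom 1 a + monom 1 (Suc a) * u" and q: "q = monom 1 b + monom 1 (Suc b) * v"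
    using assms unfolding monic_order_def by blast
  have X: "monom 1 (Suc a) = monom 1 a * monom (1::'a) 1" for a by (simp add: mult_monom)
  have Y: "monom 1 (a + b) = monom 1 a * monom (1::'a) b" by (simp add: mult_monom)
  have "p * q = monom 1 (a + b) + monom 1 (Suc (a + b)) * (u + v + monom 1 1 * u * v)"
    unfolding p q X Y by (simp only: algebra_simps)
  then show ?thesis unfolding monic_order_def by blast
qed

lemma monic_order_1: "monic_order 1 0"
  unfolding monic_order_def by (rule exI[of _ 0]) (simp add: monom_0 one_pCons)

lemma monic_order_power: "monic_order p a \<Longrightarrow> monic_order (p ^ n) (n * a)"
  by (induction n) (simp_all add: monic_order_1 monic_order_mult)

lemma monic_order_prod:
  "(\<And>j. j < i \<Longrightarrow> monic_order (p j) (a j)) \<Longrightarrow> monic_order (\<Prod>j<i. p j) (\<Sum>j<i. a j)" for i :: nat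
  by (induction i) (simp_all add: monic_order_1 monic_order_mult)

lemma monic_order_add:
  assumes "monic_order p a" "monom 1 (Suc a) dvd q" shows "monic_order (p + q) a"
proof -
  obtain u where "p = monom 1 a + monom 1 (Suc a) * u" using assms(1) unfolding monic_order_def by blast
  moreover obtain v where "q = monom 1 (Suc a) * v" using assms(2) by (rule dvdE)
  ultimately have "p + q = monom 1 a + monom 1 (Suc a) * (u + v)" by (simp add: distrib_left)
  then show ?thesis unfolding monic_order_def by blast
qed

lemma coeff_monic_order: "monic_order p a \<Longrightarrow> n \<le> a \<Longrightarrow> coeff p n = (if n = a then 1 else 0)"
  unfolding monic_order_def by (auto simp: coeff_monom_mult)

text \<open>
  In a linear combination with distinct orders the term of lowest order cannot cancel.
\<close>

lemma monic_order_independent: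
  fixes p :: "nat \<Rightarrow> 'a::field_char_0 poly"
  assumes p: "\<And>i. i < N \<Longrightarrow> monic_order (p i) (a i)" and inj: "inj_on a {..<N}"
    and zero: "\<And>t. (\<Sum>i<N. c i * poly (p i) t) = 0"
  shows "\<forall>i<N. c i = 0"
proof (rule ccontr)
  assume "\<not> ?thesis"
  then obtain i where i: "i < N \<and> c i \<noteq> 0"
    and least: "\<And>j. j < N \<and> c j \<noteq> 0 \<Longrightarrow> a i \<le> a j"
    using ex_has_least_nat[of "\<lambda>i. i < N \<and> c i \<noteq> 0" _ a] by blast
  have "poly (\<Sum>i<N. smult (c i) (p i)) = poly 0"
    by (rule ext) (simp add: poly_sum zero)
  then have "(\<Sum>i<N. smult (c i) (p i)) = 0" by (simp add: poly_eq_poly_eq_iff)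
  then have "0 = coeff (\<Sum>j<N. smult (c j) (p j)) (a i)" by simp
  also have "\<dots> = (\<Sum>j<N. if j = i then c i else 0)"
    unfolding coeff_sum
  proof (rule sum.cong)
    fix j assume j: "j \<in> {..<N}"
    show "coeff (smult (c j) (p j)) (a i) = (if j = i then c i else 0)"
    proof (cases "c j = 0")
      case False
      then have "a i \<le> a j" using least j by simp
      moreover have "j \<noteq> i \<Longrightarrow> a i \<noteq> a j" using inj i j by (auto simp: inj_on_def)
      ultimately show ?thesis using coeff_monic_order[OF p, of j "a i"] j by auto
    qed (use i in auto)
  qed simp
  also have "\<dots> = c i" using i by simp
  finally show False using i by simp
qed

lemma sum_digits: "(\<Sum>j<i. (r div q ^ j) mod q * q ^ j) = r mod q ^ i" for q r i :: nat
proof (induction i)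
  case (Suc i)
  have "r mod (q ^ i * q) = q ^ i * (r div q ^ i mod q) + r mod q ^ i" by (rule mod_mult2_eq)
  then show ?case using Suc by (simp add: mult.commute)
qed simp

section \<open>Affine charts of the Grassmannian\<close>

locale grassmannian_charts = exterior_power scaleV scaleW k wedge
  for scaleV :: "'a::field_char_0 \<Rightarrow> 'v::ab_group_add \<Rightarrow> 'v"
    and scaleW :: "'a \<Rightarrow> 'w::ab_group_add \<Rightarrow> 'w"
    and k :: nat
    and wedge :: "'v list \<Rightarrow> 'w" +
  fixes es :: "'v list" and l :: nat
  assumes es: "distinct es" "V.independent (set es)" "V.span (set es) = UNIV" "length es = k + l"
begin

sublocale P: projective_space_char_0 scaleW ..

text \<open>
  The orderings of the fixed basis.  Each gives a chart of the Grassmannian, of which the first \<open>k\<close>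
  vectors play the role of the pivots.
\<close>

definition frames :: "'v list set" where
  "frames = {bs. distinct bs \<and> set bs = set es}"

lemma frames_length: "bs \<in> frames \<Longrightarrow> length bs = k + l"
  unfolding frames_def using es by (auto simp: distinct_card[symmetric])

lemma finite_frames: "finite frames"
proof (rule finite_subset)
  show "frames \<subseteq> {bs. set bs \<subseteq> set es \<and> length bs = k + l}"
    using frames_length by (auto simp: frames_def)
qed (simp add: finite_lists_length_eq)

text \<open>
  The \<open>k \<times> l\<close> matrix \<open>A\<close>, stored row by row, describes the graph of a linear map from the span of the
  first \<open>k\<close> vectors of \<open>bs\<close> to the span of the last \<open>l\<close>; the list is the standard basis of this graph.
\<close>

definition chart :: "'v list \<Rightarrow> (nat \<Rightarrow> 'a) \<Rightarrow> 'v list" where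
  "chart bs A = map (\<lambda>i. bs ! i + (\<Sum>j<l. scaleV (A (i * l + j)) (bs ! (k + j)))) [0..<k]"

lemma length_chart [simp]: "length (chart bs A) = k"
  by (simp add: chart_def)

lemma entry_index: "i < k \<Longrightarrow> j < l \<Longrightarrow> i * l + j < k * l"
proof -
  assume "i < k" "j < l"
  then have "i * l + j < Suc i * l" by simp
  also have "\<dots> \<le> k * l" using \<open>i < k\<close> by (intro mult_le_mono1) simp
  finally show ?thesis .
qed

lemma chart_cong: "(\<And>j. j < k * l \<Longrightarrow> A j = A' j) \<Longrightarrow> chart bs A = chart bs A'"
  by (simp add: chart_def entry_index)

lemma linear_representation: "Vector_Spaces.linear scaleV (*) (\<lambda>v. V.representation (set es) v b)"
proof -
  interpret K: vector_space "(*) :: 'a \<Rightarrow> 'a \<Rightarrow> 'a"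
    by unfold_locales (simp_all add: algebra_simps)
  show ?thesis
    unfolding Vector_Spaces.linear_iff
    using es by (auto simp: V.representation_add V.representation_scale V.vector_space_axioms K.vector_space_axioms)
qed

text \<open>
  The coordinate matrix of a chart: an identity block followed by the block \<open>A\<close>.
\<close>

definition chart_entry :: "(nat \<Rightarrow> 'b::comm_ring_1) \<Rightarrow> nat \<Rightarrow> nat \<Rightarrow> 'b" where
  "chart_entry A a r = (if a < k then if a = r then 1 else 0 else A (r * l + (a - k)))"

lemma representation_chart:
  assumes bs: "bs \<in> frames" and a: "a < k + l" and r: "r < k"
  shows "V.representation (set es) (chart bs A ! r) (bs ! a) = chart_entry A a r"
proof -
  let ?c = "\<lambda>v. V.representation (set es) v (bs ! a)"
  interpret c: Vector_Spaces.linear scaleV "(*)" ?c by (rule linear_representation)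
  have basis: "?c (bs ! x) = (if x = a then 1 else 0)" if "x < k + l" for x
  proof -
    have bs': "length bs = k + l" "distinct bs" "set bs = set es"
      using bs frames_length[OF bs] by (auto simp: frames_def)
    then have "bs ! x \<in> set es" using that by (metis nth_mem)
    then show ?thesis
      using that a bs' by (auto simp: V.representation_basis[OF es(2)] nth_eq_iff_index_eq)
  qed
  have "?c (chart bs A ! r) = ?c (bs ! r) + (\<Sum>j<l. A (r * l + j) * ?c (bs ! (k + j)))"
    using r by (simp add: chart_def c.add c.sum c.scale)
  also have "\<dots> = (if r = a then 1 else 0) + (\<Sum>j<l. if k + j = a then A (r * l + j) else 0)"
    using r by (simp add: basis if_distrib[of "\<lambda>x. _ * x"] cong: if_cong)
  also have "\<dots> = chart_entry A a r"
  proof (cases "a < k")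
    case False
    then have "(\<Sum>j<l. if k + j = a then A (r * l + j) else 0) = (\<Sum>j<l. if j = a - k then A (r * l + j) else 0)"
      by (intro sum.cong) auto
    then show ?thesis using False a r by (simp add: chart_entry_def)
  qed (auto simp: chart_entry_def)
  finally show ?thesis .
qed

lemma chart_independent:
  assumes bs: "bs \<in> frames"
  shows "distinct (chart bs A)" "V.independent (set (chart bs A))"
proof -
  have dual: "V.representation (set es) (chart bs A ! r) (bs ! a) = (if a = r then 1 else 0)"
    if "a < k" "r < k" for a r
    using representation_chart[OF bs, of a r A] that by (simp add: chart_entry_def)
  show dist: "distinct (chart bs A)"
    unfolding distinct_conv_nth
  proof (intro allI impI)
    fix i j assume ij: "i < length (chart bs A)" "j < length (chart bs A)" "i \<noteq> j"
    then show "chart bs A ! i \<noteq> chart bs A ! j"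
      using dual[of i i] dual[of i j] by auto
  qed
  show "V.independent (set (chart bs A))"
  proof (rule V.independent_if_scalars_zero)
    fix f x assume zero: "(\<Sum>v\<in>set (chart bs A). scaleV (f v) v) = 0" and "x \<in> set (chart bs A)"
    then obtain i where i: "i < k" "x = chart bs A ! i" by (metis in_set_conv_nth length_chart)
    let ?c = "\<lambda>v. V.representation (set es) v (bs ! i)"
    interpret c: Vector_Spaces.linear scaleV "(*)" ?c by (rule linear_representation)
    have "0 = ?c (\<Sum>v\<in>set (chart bs A). scaleV (f v) v)" by (simp add: zero c.zero)
    also have "\<dots> = (\<Sum>v\<in>set (chart bs A). f v * ?c v)" by (simp add: c.sum c.scale)
    also have "\<dots> = (\<Sum>v\<in>set (chart bs A). if v = x then f x else 0)"
    proof (rule sum.cong)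
      fix v assume "v \<in> set (chart bs A)"
      then obtain j where j: "j < k" "v = chart bs A ! j" by (metis in_set_conv_nth length_chart)
      then show "f v * ?c v = (if v = x then f x else 0)"
        using dual[of i j] i dist by (auto simp: nth_eq_iff_index_eq)
    qed simp
    also have "\<dots> = f x" using \<open>x \<in> set (chart bs A)\<close> by simp
    finally show "f x = 0" by simp
  qed simp
qed

lemma chart_subspace:
  assumes bs: "bs \<in> frames"
  shows "V.span (set (chart bs A)) \<in> grassmannian"
    and "plucker (V.span (set (chart bs A))) = W.span {wedge (chart bs A)}"
proof -
  have "V.dim (V.span (set (chart bs A))) = k"
    using chart_independent[OF bs, of A] by (simp add: V.dim_eq_card_independent distinct_card)
  then show "V.span (set (chart bs A)) \<in> grassmannian"
    by (simp add: grassmannian_def V.subspace_span)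
  have "basis_of (chart bs A) (V.span (set (chart bs A)))"
    using chart_independent[OF bs] by (simp add: basis_of_def)
  then show "plucker (V.span (set (chart bs A))) = W.span {wedge (chart bs A)}"
    by (rule plucker_eq) simp
qed

text \<open>
  A basis of \<open>U\<close> can be completed to a basis of \<open>V\<close> by \<open>l\<close> of the given basis vectors.  Modulo their
  span, each of the other \<open>k\<close> basis vectors is congruent to an element of \<open>U\<close>, and these elements form
  the list of a chart.
\<close>

lemma charts_cover:
  assumes U: "U \<in> grassmannian"
  shows "\<exists>bs\<in>frames. \<exists>A. V.span (set (chart bs A)) = U"
proof -
  interpret F: finite_dimensional_vector_space scaleV "set es"
    by unfold_locales (use es in auto)
  have subU: "V.subspace U" and dimU: "V.dim U = k" using U by (auto simp: grassmannian_def)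
  obtain B0 where B0: "B0 \<subseteq> U" "V.independent B0" "U \<subseteq> V.span B0" "card B0 = k"
    using V.basis_exists[of U] dimU by metis
  have spanB0: "V.span B0 = U" using B0 subU by (meson V.span_minimal subset_antisym)
  obtain B where B: "B0 \<subseteq> B" "B \<subseteq> B0 \<union> set es" "V.independent B" "B0 \<union> set es \<subseteq> V.span B"
    using V.maximal_independent_subset_extend[of B0 "B0 \<union> set es"] B0(2) by blast
  have spanB: "V.span B = UNIV"
    using B(4) es(3) by (metis Un_subset_iff V.span_minimal V.subspace_span top.extremum_uniqueI)
  have finB: "finite B" using B(3) by (rule F.finiteI_independent)
  have cardB: "card B = k + l"
    using V.dim_span_eq_card_independent[OF B(3)] spanB es by (simp add: distinct_card)
  define B' where "B' = B - B0"
  have B': "B' \<subseteq> set es" "card B' = l" "finite B'" "B = B0 \<union> B'"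
    using B cardB B0(4) finB by (auto simp: B'_def card_Diff_subset finite_subset)
  obtain xs where xs: "set xs = set es - B'" "distinct xs" using finite_distinct_list[of "set es - B'"] by auto
  obtain ys where ys: "set ys = B'" "distinct ys" using finite_distinct_list[OF B'(3)] by auto
  have len: "length ys = l" "length xs = k"
    using B' xs ys es by (auto simp: distinct_card[symmetric] card_Diff_subset)
  define bs where "bs = xs @ ys"
  have bs: "bs \<in> frames" using xs ys B'(1) by (auto simp: frames_def bs_def)
  have "\<exists>c. bs ! i + (\<Sum>j<l. scaleV (c j) (bs ! (k + j))) \<in> U" if i: "i < k" for i
  proof -
    have "bs ! i \<in> V.span (B0 \<union> B')" using spanB B'(4) by simp
    then obtain u v where uv: "bs ! i = u + v" "u \<in> U" "v \<in> V.span B'"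
      unfolding V.span_Un spanB0 by blast
    then obtain f where f: "v = (\<Sum>b\<in>B'. scaleV (f b) b)" using V.span_finite[OF B'(3)] by auto
    also have "\<dots> = (\<Sum>j<l. scaleV (f (ys ! j)) (ys ! j))"
      using ys len by (intro sum.reindex_bij_betw[symmetric] bij_betw_nth) auto
    finally have "(\<Sum>j<l. scaleV (- f (ys ! j)) (bs ! (k + j))) = - v"
      using len by (simp add: bs_def nth_append sum_negf)
    then show ?thesis using uv by (intro exI[of _ "\<lambda>j. - f (ys ! j)"]) simp
  qed
  then obtain c where c: "\<And>i. i < k \<Longrightarrow> bs ! i + (\<Sum>j<l. scaleV (c i j) (bs ! (k + j))) \<in> U" by metis
  define A where "A m = c (m div l) (m mod l)" for m
  have "A (i * l + j) = c i j" if "j < l" for i j using that by (simp add: A_def)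
  then have "set (chart bs A) \<subseteq> U" using c by (auto simp: chart_def)
  moreover from this have "U \<subseteq> V.span (set (chart bs A))"
    using chart_independent[OF bs, of A] dimU
    by (intro F.card_ge_dim_independent) (simp_all add: distinct_card)
  ultimately have "V.span (set (chart bs A)) = U"
    using subU by (meson V.span_minimal subset_antisym)
  then show ?thesis using bs by blast
qed

text \<open>
  The wedge product is linear in each of its \<open>k\<close> arguments, so each argument contributes at most one to
  the degree.
\<close>

lemma poly_fun_wedge_chart:
  assumes g: "\<And>j. poly_fun m 1 (\<lambda>y. g y j)" and f: "Vector_Spaces.linear scaleW (*) f"
  shows "poly_fun m k (\<lambda>y. f (wedge (chart bs (g y))))"
proof -
  \<comment> \<open>The first \<open>r\<close> arguments are those of the chart, the others are constant; induction on \<open>r\<close> then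
    changes one argument at a time.\<close>
  define mix where "mix r vs y = map (\<lambda>i. if i < r then chart bs (g y) ! i else vs ! i) [0..<k]" for r vs y
  have "poly_fun m r (\<lambda>y. f (wedge (mix r vs y)))" if "r \<le> k" for r vs
    using that
  proof (induction r arbitrary: vs)
    case 0
    have "mix 0 vs y = map ((!) vs) [0..<k]" for y by (simp add: mix_def)
    then show ?case by (simp add: poly_fun_const)
  next
    case (Suc r)
    have upd: "mix (Suc r) vs y = (mix r vs y)[r := chart bs (g y) ! r]" for y
      using Suc.prems by (intro nth_equalityI) (auto simp: mix_def nth_list_update less_Suc_eq)
    have upd': "(mix r vs y)[r := v] = mix r (map (\<lambda>i. if i = r then v else vs ! i) [0..<k]) y" for y v
      using Suc.prems by (intro nth_equalityI) (auto simp: mix_def nth_list_update)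
    have "f (wedge (mix (Suc r) vs y)) = f (wedge ((mix r vs y)[r := bs ! r]))
       + (\<Sum>j<l. g y (r * l + j) * f (wedge ((mix r vs y)[r := bs ! (k + j)])))" for y
    proof -
      have "Vector_Spaces.linear scaleV scaleW (\<lambda>x. wedge ((mix r vs y)[r := x]))"
        using Suc.prems by (intro wedge_linear) (auto simp: mix_def)
      then interpret w: Vector_Spaces.linear scaleV scaleW "\<lambda>x. wedge ((mix r vs y)[r := x])" .
      interpret f: Vector_Spaces.linear scaleW "(*)" f by (rule f)
      show ?thesis unfolding upd
        using Suc.prems by (simp add: chart_def w.add w.sum w.scale f.add f.sum f.scale)
    qed
    moreover have "poly_fun m (Suc r) (\<lambda>y. f (wedge ((mix r vs y)[r := bs ! r]))
       + (\<Sum>j<l. g y (r * l + j) * f (wedge ((mix r vs y)[r := bs ! (k + j)]))))"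
    proof (rule poly_fun_add[OF _ poly_fun_sum])
      have IH: "poly_fun m r (\<lambda>y. f (wedge ((mix r vs y)[r := v])))" for v
        unfolding upd' by (rule Suc.IH) (use Suc.prems in simp)
      show "poly_fun m (Suc r) (\<lambda>y. f (wedge ((mix r vs y)[r := bs ! r])))"
        by (rule poly_fun_mono[OF IH]) simp
      show "poly_fun m (Suc r) (\<lambda>y. g y (r * l + j) * f (wedge ((mix r vs y)[r := bs ! (k + j)])))" for j
        using poly_fun_mult[OF g IH] by simp
    qed
    ultimately show ?case by simp
  qed
  from this[of k "[]"] have "poly_fun m k (\<lambda>y. f (wedge (mix k [] y)))" by simp
  moreover have "mix k [] y = chart bs (g y)" for y
    by (intro nth_equalityI) (auto simp: mix_def)
  ultimately show ?thesis by simp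
qed

section \<open>Pluecker coordinates\<close>

lemma alternating_leibniz:
  "alternating scaleV (*) k (\<lambda>vs. leibniz k (\<lambda>a r. V.representation (set es) (vs ! r) (b a)))"
  unfolding alternating_def
proof (intro conjI allI impI)
  interpret K: vector_space "(*) :: 'a \<Rightarrow> 'a \<Rightarrow> 'a"
    by unfold_locales (simp_all add: algebra_simps)
  let ?c = "\<lambda>b v. V.representation (set es) v b"
  fix vs :: "'v list" and i assume vs: "length vs = k \<and> i < k"
  have expand: "leibniz k (\<lambda>a r. ?c (b a) (vs[i := x] ! r)) =
      (\<Sum>p | p permutes {..<k}. of_int (sign p) * (?c (b (p i)) x * (\<Prod>r\<in>{..<k} - {i}. ?c (b (p r)) (vs ! r))))" for x
    unfolding leibniz_def
  proof (rule sum.cong)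
    fix p
    have "(\<Prod>r<k. ?c (b (p r)) (vs[i := x] ! r)) =
        ?c (b (p i)) (vs[i := x] ! i) * (\<Prod>r\<in>{..<k} - {i}. ?c (b (p r)) (vs[i := x] ! r))"
      using vs by (intro prod.remove) auto
    also have "(\<Prod>r\<in>{..<k} - {i}. ?c (b (p r)) (vs[i := x] ! r)) = (\<Prod>r\<in>{..<k} - {i}. ?c (b (p r)) (vs ! r))"
      by (intro prod.cong) auto
    finally show "of_int (sign p) * (\<Prod>r<k. ?c (b (p r)) (vs[i := x] ! r)) =
      of_int (sign p) * (?c (b (p i)) x * (\<Prod>r\<in>{..<k} - {i}. ?c (b (p r)) (vs ! r)))"
      using vs by simp
  qed simp
  have add: "?c b (x + y) = ?c b x + ?c b y" and scale: "?c b (scaleV s x) = s * ?c b x" for b x y s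
    using linear_representation[of b] by (auto simp: Vector_Spaces.linear_iff)
  show "Vector_Spaces.linear scaleV (*) (\<lambda>x. leibniz k (\<lambda>a r. ?c (b a) (vs[i := x] ! r)))"
    unfolding Vector_Spaces.linear_iff expand
  proof (intro conjI allI V.vector_space_axioms K.vector_space_axioms)
    let ?t = "\<lambda>p x. of_int (sign p) * (?c (b (p i)) x * (\<Prod>r\<in>{..<k} - {i}. ?c (b (p r)) (vs ! r)))"
    show "(\<Sum>p | p permutes {..<k}. ?t p (x + y)) =
        (\<Sum>p | p permutes {..<k}. ?t p x) + (\<Sum>p | p permutes {..<k}. ?t p y)" for x y
      unfolding sum.distrib[symmetric] by (rule sum.cong) (simp_all add: add distrib_left distrib_right)
    show "(\<Sum>p | p permutes {..<k}. ?t p (scaleV s x)) = s * (\<Sum>p | p permutes {..<k}. ?t p x)" for s x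
      unfolding sum_distrib_left by (rule sum.cong) (simp_all add: scale mult.left_commute)
  qed
next
  fix vs :: "'v list" assume vs: "length vs = k \<and> \<not> distinct vs"
  then obtain i j where ij: "i < k" "j < k" "i \<noteq> j" "vs ! i = vs ! j"
    by (auto simp: distinct_conv_nth)
  then show "leibniz k (\<lambda>a r. V.representation (set es) (vs ! r) (b a)) = 0"
    by (intro leibniz_equal_columns[OF ij(1-3)]) simp
qed

text \<open>
  The coordinate of a multivector at the index list \<open>J 0, \<dots>, J (k - 1)\<close>; by the universal property it is
  determined by its values on wedge products, which are minors.
\<close>

definition plucker_coord :: "(nat \<Rightarrow> nat) \<Rightarrow> 'w \<Rightarrow> 'a" where
  "plucker_coord J = (SOME f. Vector_Spaces.linear scaleW (*) f \<and> (\<forall>vs. length vs = k \<longrightarrow>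
     f (wedge vs) = leibniz k (\<lambda>a r. V.representation (set es) (vs ! r) (es ! J a))))"

lemma
  shows linear_plucker_coord: "Vector_Spaces.linear scaleW (*) (plucker_coord J)"
    and plucker_coord_wedge: "length vs = k \<Longrightarrow>
      plucker_coord J (wedge vs) = leibniz k (\<lambda>a r. V.representation (set es) (vs ! r) (es ! J a))"
proof -
  have "\<exists>f. Vector_Spaces.linear scaleW (*) f \<and> (\<forall>vs. length vs = k \<longrightarrow>
     f (wedge vs) = leibniz k (\<lambda>a r. V.representation (set es) (vs ! r) (es ! J a)))"
    using universal_form[OF alternating_leibniz[of "\<lambda>a. es ! J a"]] by blast
  from someI_ex[OF this] show "Vector_Spaces.linear scaleW (*) (plucker_coord J)"
    "length vs = k \<Longrightarrow>
      plucker_coord J (wedge vs) = leibniz k (\<lambda>a r. V.representation (set es) (vs ! r) (es ! J a))"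
    unfolding plucker_coord_def by auto
qed

text \<open>
  The Pluecker coordinate with columns \<open>J 0, \<dots>, J (k - 1)\<close> of the point with chart matrix \<open>A\<close>.
\<close>

definition minor :: "(nat \<Rightarrow> nat) \<Rightarrow> (nat \<Rightarrow> 'b::comm_ring_1) \<Rightarrow> 'b" where
  "minor J A = leibniz k (\<lambda>a r. chart_entry A (J a) r)"

lemma poly_minor: "poly (minor J A) t = minor J (\<lambda>j. poly (A j) t)"
  unfolding minor_def poly_leibniz by (rule leibniz_cong) (simp add: chart_entry_def)

text \<open>
  Exchanging a single pivot for another column yields the entries of \<open>A\<close> themselves; these are the
  Pluecker coordinates that are linear in the chart.
\<close>

lemma minor_unit:
  assumes "i < k" "\<And>a. a < k \<Longrightarrow> a \<noteq> i \<Longrightarrow> J a = a"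
  shows "minor J A = chart_entry A (J i) i"
  unfolding minor_def by (rule leibniz_unit_rows) (use assms in \<open>auto simp: chart_entry_def\<close>)

text \<open>
  If at most one pivot column is kept, the minor is of order at least \<open>k - 1\<close> in the entries of \<open>A\<close>.
\<close>

lemma dvd_minor:
  assumes "i < k" "\<And>a. a < k \<Longrightarrow> a \<noteq> i \<Longrightarrow> k \<le> J a" "\<And>j. x dvd A j"
  shows "x ^ (k - 1) dvd minor J A"
  unfolding minor_def by (rule dvd_leibniz[OF assms(1)]) (use assms(2,3) in \<open>force simp: chart_entry_def\<close>)

end

section \<open>Parametrizing the secant lines\<close>

definition truncate :: "nat \<Rightarrow> (nat \<Rightarrow> 'a::zero) \<Rightarrow> nat \<Rightarrow> 'a" where
  "truncate m y j = (if j < m then y j else 0)"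

lemma poly_fun_truncate: "poly_fun m 1 (\<lambda>y. truncate m y j)"
  by (cases "j < m") (simp_all add: truncate_def poly_fun_const poly_fun_var[of j m 0, simplified])

context grassmannian_charts
begin

text \<open>
  By homogeneity the coefficient of the first point can be normalized to \<open>1\<close>.  The second coefficient
  is written as \<open>1 + y 0\<close>, so that at the origin of the parameter space both points contribute.
\<close>

definition secant_param :: "'v list \<Rightarrow> 'v list \<Rightarrow> (nat \<Rightarrow> 'a) \<Rightarrow> 'w" where
  "secant_param bs bs' y = wedge (chart bs (\<lambda>j. y (1 + j))) +
     scaleW (1 + y 0) (wedge (chart bs' (\<lambda>j. y (1 + k * l + j))))"

definition secant_dim :: nat where
  "secant_dim = 2 * k * l + 1"

lemma poly_map_secant_param: "P.poly_map m (k + 1) (\<lambda>y. secant_param bs bs' (truncate m y))"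
  unfolding P.poly_map_def
proof (intro allI impI)
  fix f assume f: "Vector_Spaces.linear scaleW (*) f"
  interpret f: Vector_Spaces.linear scaleW "(*)" f by (rule f)
  have 1: "poly_fun m (k + 1) (\<lambda>y. f (wedge (chart bs (\<lambda>j. truncate m y (1 + j)))))"
    by (rule poly_fun_mono[OF poly_fun_wedge_chart[OF poly_fun_truncate f]]) simp
  have "poly_fun m 1 (\<lambda>y. 1 + truncate m y 0)"
    by (rule poly_fun_add[OF poly_fun_const poly_fun_truncate])
  then have 2: "poly_fun m (k + 1) (\<lambda>y. (1 + truncate m y 0) * f (wedge (chart bs' (\<lambda>j. truncate m y (1 + k * l + j)))))"
    using poly_fun_mult[OF poly_fun_wedge_chart[OF poly_fun_truncate f], of m 1 "\<lambda>y. 1 + truncate m y 0" bs' "\<lambda>j. 1 + k * l + j"]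
    by (simp add: mult.commute)
  show "poly_fun m (k + 1) (\<lambda>y. f (secant_param bs bs' (truncate m y)))"
    using poly_fun_add[OF 1 2] by (simp add: secant_param_def f.add f.scale)
qed

definition secant_points :: "'w set set" where
  "secant_points = \<Union>{P.proj_span S | S. S \<subseteq> plucker ` grassmannian \<and> finite S \<and> card S = 2}"

lemma secant_points_subset: "secant_points \<subseteq> P.proj_space"
  unfolding secant_points_def P.proj_span_def by blast

text \<open>
  For \<open>x = a * w + b * w'\<close> with \<open>a\<close> nonzero the parameter of the line is \<open>b / a\<close>; if \<open>a\<close> is zero, the two
  points are exchanged and the parameter is \<open>0\<close>.
\<close>

lemma secant_points_covered:
  assumes "x \<in> \<Union>secant_points"
  shows "\<exists>(bs, bs')\<in>frames \<times> frames. \<exists>a y. x = scaleW a (secant_param bs bs' (truncate secant_dim y))"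
proof -
  obtain S L where S: "S \<subseteq> plucker ` grassmannian" "card S = 2" "L \<in> P.proj_span S" "x \<in> L"
    using assms unfolding secant_points_def by blast
  obtain P1 P2 where P: "S = {P1, P2}" using S(2) by (auto simp: card_2_iff)
  then have "P1 \<in> plucker ` grassmannian" "P2 \<in> plucker ` grassmannian" using S(1) by auto
  then obtain U1 U2 where U: "U1 \<in> grassmannian" "U2 \<in> grassmannian" "S = {plucker U1, plucker U2}"
    using P by blast
  obtain bs A where bs: "bs \<in> frames" "V.span (set (chart bs A)) = U1" using charts_cover[OF U(1)] by blast
  obtain bs' A' where bs': "bs' \<in> frames" "V.span (set (chart bs' A')) = U2" using charts_cover[OF U(2)] by blast
  have "x \<in> W.span (\<Union>S)" using S(3,4) unfolding P.proj_span_def by blast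
  also have "W.span (\<Union>S) = W.span (W.span {wedge (chart bs A)} \<union> W.span {wedge (chart bs' A')})"
    unfolding U(3) using chart_subspace(2)[OF bs(1), of A] chart_subspace(2)[OF bs'(1), of A']
    by (simp add: bs(2) bs'(2))
  also have "\<dots> = W.span ({wedge (chart bs A)} \<union> {wedge (chart bs' A')})"
    by (simp only: W.span_Un W.span_span)
  finally obtain a b where x: "x = scaleW a (wedge (chart bs A)) + scaleW b (wedge (chart bs' A'))"
    unfolding W.span_Un W.span_singleton by auto
  define y where "y c A A' j = (if j = 0 then c - 1 else if j \<le> k * l then A (j - 1) else A' (j - 1 - k * l))"
    for c :: 'a and A A' :: "nat \<Rightarrow> 'a" and j
  have param: "secant_param bs bs' (truncate secant_dim (y c A A')) =
      wedge (chart bs A) + scaleW c (wedge (chart bs' A'))" for bs bs' A A' c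
  proof -
    have "chart bs (\<lambda>j. truncate secant_dim (y c A A') (1 + j)) = chart bs A"
      by (rule chart_cong) (simp add: truncate_def y_def secant_dim_def)
    moreover have "chart bs' (\<lambda>j. truncate secant_dim (y c A A') (1 + k * l + j)) = chart bs' A'"
      by (rule chart_cong) (simp add: truncate_def y_def secant_dim_def)
    moreover have "1 + truncate secant_dim (y c A A') 0 = c" by (simp add: truncate_def y_def secant_dim_def)
    ultimately show ?thesis by (simp only: secant_param_def)
  qed
  show ?thesis
  proof (cases "a = 0")
    case True
    then have "x = scaleW b (secant_param bs' bs (truncate secant_dim (y 0 A' A)))"
      using x by (simp add: param)
    then show ?thesis using bs(1) bs'(1) by blast
  next
    case False
    then have "x = scaleW a (secant_param bs bs' (truncate secant_dim (y (b / a) A A')))"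
      using x by (simp add: param W.scale_right_distrib)
    then show ?thesis using bs(1) bs'(1) by blast
  qed
qed

lemma proj_dim_secant_le: "P.proj_dim (P.zariski closure_of secant_points) \<le> enat secant_dim"
proof (rule P.proj_dim_le[where C = "frames \<times> frames" and D = "k + 1"
      and \<phi> = "\<lambda>(bs, bs') y. secant_param bs bs' (truncate secant_dim y)"])
  show "P.poly_map secant_dim (k + 1) ((\<lambda>(bs, bs') y. secant_param bs bs' (truncate secant_dim y)) c)" for c
    by (cases c) (simp only: split poly_map_secant_param)
  show "\<exists>c\<in>frames \<times> frames. \<exists>a y. x = scaleW a ((\<lambda>(bs, bs') y. secant_param bs bs' (truncate secant_dim y)) c y)"
    if "x \<in> \<Union>secant_points" for x
    using secant_points_covered[OF that] by (simp add: split_beta)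
qed (simp_all add: finite_frames secant_points_subset)

end

section \<open>Two transversal charts\<close>

text \<open>
  Since \<open>k \<le> l\<close>, the basis contains two disjoint blocks of \<open>k\<close> vectors, hence two transversal subspaces
  around which the charts are compared.
\<close>

locale transversal_charts = grassmannian_charts scaleV scaleW k wedge es l
  for scaleV :: "'a::field_char_0 \<Rightarrow> 'v::ab_group_add \<Rightarrow> 'v"
    and scaleW :: "'a \<Rightarrow> 'w::ab_group_add \<Rightarrow> 'w"
    and k :: nat
    and wedge :: "'v list \<Rightarrow> 'w"
    and es :: "'v list" and l :: nat +
  assumes k3: "3 \<le> k" and kl: "k \<le> l"
begin

definition swap :: "nat \<Rightarrow> nat" where
  "swap a = (if a < k then k + a else if a < 2 * k then a - k else a)"

lemma swap_swap [simp]: "swap (swap a) = a"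
  by (auto simp: swap_def)

lemma swap_less: "swap a < k + l \<longleftrightarrow> a < k + l"
  using kl by (auto simp: swap_def)

definition opposite :: "'v list" where
  "opposite = map (\<lambda>a. es ! swap a) [0..<k + l]"

lemma es_frame: "es \<in> frames"
  using es by (simp add: frames_def)

lemma opposite_frame: "opposite \<in> frames"
proof -
  have swap_image: "swap ` {..<k + l} = {..<k + l}"
  proof
    show "swap ` {..<k + l} \<subseteq> {..<k + l}" by (auto simp: swap_less)
    show "{..<k + l} \<subseteq> swap ` {..<k + l}"
    proof
      fix a assume "a \<in> {..<k + l}"
      then have "swap a \<in> {..<k + l}" by (simp add: swap_less)
      then have "swap (swap a) \<in> swap ` {..<k + l}" by (rule imageI)
      then show "a \<in> swap ` {..<k + l}" by simp
    qed
  qed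
  have "set opposite = (!) es ` (swap ` {..<k + l})"
    unfolding opposite_def by (auto simp: image_image atLeast0LessThan)
  then have "set opposite = set es"
    unfolding swap_image using es(4) by (auto simp: set_conv_nth)
  moreover have "distinct opposite"
    unfolding opposite_def distinct_map
  proof (intro conjI inj_onI)
    fix a b assume "a \<in> set [0..<k + l]" "b \<in> set [0..<k + l]" "es ! swap a = es ! swap b"
    then have "swap a = swap b" using es(1,4) by (simp add: nth_eq_iff_index_eq swap_less)
    then have "swap (swap a) = swap (swap b)" by simp
    then show "a = b" by simp
  qed simp
  ultimately show ?thesis by (simp add: frames_def)
qed

lemma plucker_coord_chart:
  assumes J: "\<And>a. a < k \<Longrightarrow> J a < k + l"
  shows "plucker_coord J (wedge (chart es A)) = minor J A"
  unfolding plucker_coord_wedge[OF length_chart] minor_def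
  by (rule leibniz_cong) (simp add: representation_chart[OF es_frame] J)

lemma plucker_coord_opposite:
  assumes J: "\<And>a. a < k \<Longrightarrow> J a < k + l"
  shows "plucker_coord J (wedge (chart opposite A)) = minor (swap \<circ> J) A"
  unfolding plucker_coord_wedge[OF length_chart] minor_def
proof (rule leibniz_cong)
  fix a r assume ar: "a < k" "r < k"
  have "es ! J a = opposite ! swap (J a)" using J[OF ar(1)] by (simp add: opposite_def swap_less)
  then show "V.representation (set es) (chart opposite A ! r) (es ! J a) = chart_entry A ((swap \<circ> J) a) r"
    using representation_chart[OF opposite_frame _ ar(2), of "swap (J a)" A] J[OF ar(1)]
    by (simp add: swap_less)
qed

lemma distinct_plucker_points:
  "\<exists>P1\<in>plucker ` grassmannian. \<exists>P2\<in>plucker ` grassmannian. P1 \<noteq> P2"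
proof -
  let ?w = "wedge (chart es (\<lambda>_. 0))" and ?w' = "wedge (chart opposite (\<lambda>_. 0))"
  interpret f: Vector_Spaces.linear scaleW "(*)" "plucker_coord id" by (rule linear_plucker_coord)
  have "plucker_coord id ?w = 1"
    using k3 by (subst plucker_coord_chart) (auto simp: minor_unit[of 0 id] chart_entry_def)
  moreover have "plucker_coord id ?w' = 0"
  proof -
    have "0 ^ (k - 1) dvd minor (swap \<circ> id) (\<lambda>_. 0 :: 'a)"
      using k3 by (intro dvd_minor[of 0]) (auto simp: swap_def)
    then show ?thesis using k3 by (simp add: plucker_coord_opposite power_0_left)
  qed
  ultimately have "?w \<notin> W.span {?w'}" by (auto simp: W.span_singleton f.scale)
  then have "W.span {?w} \<noteq> W.span {?w'}" by (metis W.span_base singletonI)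
  moreover have "W.span {?w} \<in> plucker ` grassmannian" "W.span {?w'} \<in> plucker ` grassmannian"
    using chart_subspace[OF es_frame] chart_subspace[OF opposite_frame] by (metis imageI)+
  ultimately show ?thesis by blast
qed

text \<open>
  The parametrization around the two opposite charts with only the first \<open>i\<close> parameters switched on.
\<close>

definition flag_param :: "nat \<Rightarrow> (nat \<Rightarrow> 'a) \<Rightarrow> 'w" where
  "flag_param i y = secant_param es opposite (truncate i y)"

text \<open>
  If the two subspaces that belong to a parameter coincide, the point lies on the Grassmannian and
  therefore on the line to any other of its points.
\<close>

lemma flag_param_image_subset: "P.param_image (flag_param i) \<subseteq> secant_points"
proof
  fix L assume "L \<in> P.param_image (flag_param i)"
  then obtain x y where x: "x \<noteq> 0" "x = secant_param es opposite y" "L = W.span {x}"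
    unfolding P.param_image_def flag_param_def by blast
  define P1 where "P1 = W.span {wedge (chart es (\<lambda>j. y (1 + j)))}"
  define P2 where "P2 = W.span {wedge (chart opposite (\<lambda>j. y (1 + k * l + j)))}"
  have P: "P1 \<in> plucker ` grassmannian" "P2 \<in> plucker ` grassmannian"
    unfolding P1_def P2_def using chart_subspace[OF es_frame] chart_subspace[OF opposite_frame]
    by (metis imageI)+
  have xP: "x \<in> W.span (P1 \<union> P2)"
    unfolding x(2) secant_param_def
    by (intro W.span_add W.span_scale W.span_base) (auto simp: P1_def P2_def W.span_base)
  obtain P3 where P3: "P3 \<in> plucker ` grassmannian" "P3 \<noteq> P1" using distinct_plucker_points by metis
  define Q where "Q = (if P1 = P2 then P3 else P2)"
  have Q: "Q \<in> plucker ` grassmannian" "Q \<noteq> P1" using P P3 by (auto simp: Q_def)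
  have "W.span (P1 \<union> P2) \<subseteq> W.span (\<Union>{P1, Q})" by (rule W.span_mono) (auto simp: Q_def)
  then have "L \<subseteq> W.span (\<Union>{P1, Q})"
    unfolding x(3) using xP by (intro W.span_minimal) auto
  moreover have "L \<in> P.proj_space" using x unfolding P.proj_space_def by blast
  ultimately have "L \<in> P.proj_span {P1, Q}" by (simp add: P.proj_span_def)
  moreover have "{P1, Q} \<subseteq> plucker ` grassmannian" "finite {P1, Q}" "card {P1, Q} = 2"
    using P Q by auto
  ultimately show "L \<in> secant_points" unfolding secant_points_def by blast
qed

text \<open>
  The Pluecker coordinate \<open>J\<close> along the curve \<open>Y\<close> in the parameter space.  The basis vector with index
  \<open>a\<close> stands at position \<open>swap a\<close> of the opposite frame, so the second point contributes the minor with
  columns \<open>swap \<circ> J\<close>.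
\<close>

definition coord_poly :: "(nat \<Rightarrow> nat) \<Rightarrow> (nat \<Rightarrow> 'a poly) \<Rightarrow> 'a poly" where
  "coord_poly J Y = minor J (\<lambda>j. Y (1 + j)) + (1 + Y 0) * minor (swap \<circ> J) (\<lambda>j. Y (1 + k * l + j))"

lemma poly_coord_poly:
  assumes "\<And>a. a < k \<Longrightarrow> J a < k + l"
  shows "poly (coord_poly J Y) t = plucker_coord J (secant_param es opposite (\<lambda>j. poly (Y j) t))"
proof -
  interpret f: Vector_Spaces.linear scaleW "(*)" "plucker_coord J" by (rule linear_plucker_coord)
  show ?thesis
    using assms
    by (simp add: coord_poly_def secant_param_def f.add f.scale poly_minor plucker_coord_chart plucker_coord_opposite)
qed

text \<open>
  This is where \<open>k \<ge> 3\<close> enters: a minor that uses at most one pivot is at least quadratic in the chart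
  parameters.
\<close>

lemma high_order_minor:
  assumes "i < k" "\<And>a. a < k \<Longrightarrow> a \<noteq> i \<Longrightarrow> k \<le> J a" "\<And>j. monom 1 N dvd A j" "w \<le> 2 * N"
  shows "monom 1 w dvd minor J (A :: nat \<Rightarrow> 'a poly)"
proof -
  have "monom (1::'a) w dvd monom 1 N ^ (k - 1)"
  proof -
    have "2 * N \<le> (k - 1) * N" using k3 by (intro mult_le_mono1) simp
    with assms(4) have "w \<le> (k - 1) * N" by (rule order_trans)
    then have "w \<le> N * (k - 1)" by (simp only: mult.commute)
    then have "monom (1::'a) (N * (k - 1)) = monom 1 w * monom 1 (N * (k - 1) - w)"
      by (simp add: mult_monom)
    then show ?thesis by (simp add: monom_power)
  qed
  also have "\<dots> dvd minor J A" using assms(1-3) by (rule dvd_minor)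
  finally show ?thesis .
qed

lemma coord_poly_id:
  assumes "\<And>j. monom 1 N dvd Y j" "w \<le> 2 * N"
  shows "\<exists>R. coord_poly id Y = 1 + (1 + Y 0) * R \<and> monom 1 w dvd R"
proof -
  have "minor id (\<lambda>j. Y (1 + j)) = 1"
    using k3 by (subst minor_unit[of 0]) (auto simp: chart_entry_def)
  moreover have "monom 1 w dvd minor (swap \<circ> id) (\<lambda>j. Y (1 + k * l + j))"
    using k3 assms by (intro high_order_minor[of 0]) (auto simp: swap_def)
  ultimately show ?thesis unfolding coord_poly_def by metis
qed

text \<open>
  Every parameter is, up to terms of higher order along the curve, a linear form on the secant
  variety.  A chart entry is a Pluecker coordinate that differs from the pivot coordinate of its own
  chart by one exchange; for the other chart this coordinate keeps at most one pivot, so it is of order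
  at least \<open>2 * N\<close>.  The parameter \<open>p = 0\<close> is the difference of the two pivot coordinates, which are
  \<open>1 + Y 0\<close> and \<open>1\<close> up to such terms.
\<close>

lemma local_coordinate:
  assumes Y: "\<And>j. monom 1 N dvd Y j" and p: "p < secant_dim" and Yp: "Y p = monom 1 w" and w: "w < 2 * N" "0 < N"
  shows "\<exists>f Q. Vector_Spaces.linear scaleW (*) f \<and> monic_order Q w \<and>
    (\<forall>t. f (secant_param es opposite (\<lambda>j. poly (Y j) t)) = poly Q t)"
proof -
  have hi: "Suc w \<le> 2 * N" using w by simp
  have Yw: "monic_order (Y p) w" unfolding Yp monic_order_def by (rule exI[of _ 0]) simp
  consider "p = 0" | "1 \<le> p" "p < 1 + k * l" | "1 + k * l \<le> p" "p < 1 + k * l + k * l"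
    using p by (force simp: secant_dim_def)
  then show ?thesis
  proof cases
    case 1
    obtain R where R: "coord_poly id Y = 1 + (1 + Y 0) * R" "monom 1 (Suc w) dvd R"
      using coord_poly_id[of N Y, OF Y hi] by blast
    define J where "J = (\<lambda>a. k + a)"
    have J: "a < k \<Longrightarrow> J a < k + l" for a using kl by (simp add: J_def)
    have "minor (swap \<circ> J) (\<lambda>j. Y (1 + k * l + j)) = 1"
      using k3 by (subst minor_unit[of 0]) (auto simp: chart_entry_def swap_def J_def)
    moreover have "monom 1 (Suc w) dvd minor J (\<lambda>j. Y (1 + j))"
      using k3 Y hi by (intro high_order_minor[of 0]) (auto simp: J_def)
    ultimately obtain R' where R': "coord_poly J Y = R' + (1 + Y 0)" "monom 1 (Suc w) dvd R'"
      unfolding coord_poly_def by simp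
    let ?f = "\<lambda>x. plucker_coord J x - plucker_coord id x"
    let ?Q = "coord_poly J Y - coord_poly id Y"
    have "?Q = Y p + (R' - (1 + Y 0) * R)" using R R' 1 by simp
    moreover have "monom 1 (Suc w) dvd R' - (1 + Y 0) * R" using R R' by simp
    ultimately have "monic_order ?Q w" using monic_order_add[OF Yw] by simp
    moreover have "Vector_Spaces.linear scaleW (*) ?f"
      using linear_plucker_coord[of J] linear_plucker_coord[of id]
      by (auto simp: Vector_Spaces.linear_iff algebra_simps)
    moreover have "?f (secant_param es opposite (\<lambda>j. poly (Y j) t)) = poly ?Q t" for t
      using J by (simp add: poly_coord_poly)
    ultimately show ?thesis by blast
  next
    case 2
    define i j where "i = (p - 1) div l" and "j = (p - 1) mod l"
    have "p - 1 < k * l" using 2 by simp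
    then have ij: "i < k" "j < l" "p = 1 + (i * l + j)"
      using 2 kl k3 by (auto simp: i_def j_def less_mult_imp_div_less)
    define J where "J = id(i := k + j)"
    have J: "a < k \<Longrightarrow> J a < k + l" for a using ij kl by (simp add: J_def)
    have "minor J (\<lambda>j. Y (1 + j)) = Y p"
      using ij by (subst minor_unit[of i]) (auto simp: chart_entry_def J_def)
    moreover have "monom 1 (Suc w) dvd minor (swap \<circ> J) (\<lambda>j. Y (1 + k * l + j))"
      using ij Y hi by (intro high_order_minor[of i]) (auto simp: J_def swap_def)
    ultimately have "monic_order (coord_poly J Y) w"
      unfolding coord_poly_def using monic_order_add[OF Yw] by simp
    then show ?thesis using linear_plucker_coord[of J] poly_coord_poly[of J Y] J by metis
  next
    case 3
    define i j where "i = (p - 1 - k * l) div l" and "j = (p - 1 - k * l) mod l"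
    have "p - 1 - k * l < k * l" using 3 by simp
    then have ij: "i < k" "j < l" "p = 1 + k * l + (i * l + j)"
      using 3 kl k3 by (auto simp: i_def j_def less_mult_imp_div_less)
    define J where "J = (\<lambda>a. k + a)(i := swap (k + j))"
    have J: "a < k \<Longrightarrow> J a < k + l" for a using ij kl by (simp add: J_def swap_less)
    have "minor (swap \<circ> J) (\<lambda>j. Y (1 + k * l + j)) = Y p"
    proof (subst minor_unit[of i])
      show "(swap \<circ> J) a = a" if "a < k" "a \<noteq> i" for a using that by (simp add: J_def swap_def)
      show "chart_entry (\<lambda>j. Y (1 + k * l + j)) ((swap \<circ> J) i) i = Y p"
        using ij by (simp add: J_def chart_entry_def)
    qed (rule ij(1))
    moreover have "monom 1 (Suc w) dvd minor J (\<lambda>j. Y (1 + j))"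
      using ij Y hi by (intro high_order_minor[of i]) (auto simp: J_def)
    moreover have "monom 1 (Suc w) dvd Y 0 * Y p"
    proof -
      obtain u where "Y 0 = monom 1 N * u" using Y[of 0] by (rule dvdE)
      then have "Y 0 * Y p = monom 1 (Suc w) * (monom 1 (N - 1) * u)"
        using w(2) by (simp add: Yp mult.assoc[symmetric] mult_monom mult.commute[of _ u] add.commute)
      then show ?thesis by simp
    qed
    ultimately have "monic_order (Y p + (minor J (\<lambda>j. Y (1 + j)) + Y 0 * Y p)) w"
      by (intro monic_order_add[OF Yw] dvd_add)
    then have "monic_order (coord_poly J Y) w"
      unfolding coord_poly_def \<open>minor (swap \<circ> J) (\<lambda>j. Y (1 + k * l + j)) = Y p\<close>
      by (simp add: algebra_simps)
    then show ?thesis using linear_plucker_coord[of J] poly_coord_poly[of J Y] J by metis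
  qed
qed

text \<open>
  The forms are the monomials \<open>g r\<close> whose exponents are the base-\<open>q\<close> digits of \<open>r\<close>, homogenized by the
  pivot coordinate \<open>f0\<close>, which is \<open>1\<close> up to terms of higher order.  The curve has weights \<open>N + q ^ p\<close>
  where \<open>N\<close> exceeds all the numbers \<open>r\<close> and \<open>q ^ p\<close>, and so \<open>g r\<close> has order \<open>r\<close> modulo \<open>N\<close>;
  distinct monomials have distinct orders.  The weights lie below \<open>2 * N\<close>, as \<open>local_coordinate\<close>
  requires.
\<close>

lemma hilbert_ge_flag:
  assumes i: "i \<le> secant_dim" and q: "2 \<le> q"
  shows "P.hilbert_ge (P.param_image (flag_param i)) (i * q) (q ^ i)"
proof -
  define N where "N = q ^ secant_dim"
  define Y :: "nat \<Rightarrow> 'a poly" where "Y p = (if p < i then monom 1 (N + q ^ p) else 0)" for p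
  define curve where "curve t = secant_param es opposite (\<lambda>j. poly (Y j) t)" for t
  have N: "0 < N" using q by (simp add: N_def)
  have small: "q ^ p < N" if "p < i" for p
    using that i q unfolding N_def by (intro power_strict_increasing) auto
  have Y: "monom 1 N dvd Y j" for j
  proof (cases "j < i")
    case True
    then have "Y j = monom 1 N * monom 1 (q ^ j)" by (simp add: Y_def mult_monom)
    then show ?thesis by simp
  qed (simp add: Y_def)
  have "\<exists>f Q. Vector_Spaces.linear scaleW (*) f \<and> monic_order Q (N + q ^ p) \<and>
    (\<forall>t. f (curve t) = poly Q t)" if "p < i" for p
    unfolding curve_def
    by (rule local_coordinate[OF Y]) (use that i N small[OF that] in \<open>auto simp: Y_def\<close>)
  then obtain f Q where f: "\<And>p. p < i \<Longrightarrow> Vector_Spaces.linear scaleW (*) (f p)"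
    and Q: "\<And>p. p < i \<Longrightarrow> monic_order (Q p) (N + q ^ p)" "\<And>p t. p < i \<Longrightarrow> f p (curve t) = poly (Q p) t"
    by metis
  define f0 where "f0 = plucker_coord id"
  define Q0 where "Q0 = coord_poly id Y"
  have f0: "Vector_Spaces.linear scaleW (*) f0" "f0 (curve t) = poly Q0 t" for t
    unfolding f0_def Q0_def curve_def by (simp_all add: linear_plucker_coord poly_coord_poly)
  have Q0: "monic_order Q0 0"
  proof -
    obtain R where R: "Q0 = 1 + (1 + Y 0) * R" "monom 1 (Suc 0) dvd R"
      using coord_poly_id[of N Y "Suc 0", OF Y] N unfolding Q0_def by auto
    show ?thesis unfolding R(1) by (rule monic_order_add[OF monic_order_1 dvd_mult[OF R(2)]])
  qed
  define e where "e r p = (r div q ^ p) mod q" for r p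
  define g where "g r x = (\<Prod>p<i. f p x ^ e r p) * f0 x ^ (i * q - (\<Sum>p<i. e r p))" for r x
  define G where "G r = (\<Prod>p<i. Q p ^ e r p) * Q0 ^ (i * q - (\<Sum>p<i. e r p))" for r
  have sum_e: "(\<Sum>p<i. e r p) \<le> i * q" for r
  proof -
    have "(\<Sum>p<i. e r p) \<le> (\<Sum>p<i. q)" using q by (intro sum_mono) (simp add: e_def)
    then show ?thesis by simp
  qed
  have "P.hom_poly (i * q) (g r)" for r
  proof -
    have "P.hom_poly (\<Sum>p<i. 1 * e r p) (\<lambda>x. \<Prod>p<i. f p x ^ e r p)"
      using f by (intro P.hom_poly_prod P.hom_poly_power P.hom_poly_linear)
    from P.hom_poly_mult[OF this P.hom_poly_power[OF P.hom_poly_linear[OF f0(1)], of "i * q - (\<Sum>p<i. e r p)"]]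
    show ?thesis unfolding g_def using sum_e[of r] by simp
  qed
  moreover have "\<forall>r<q ^ i. c r = 0"
    if c: "\<forall>x\<in>\<Union>(P.param_image (flag_param i)). (\<Sum>r<q ^ i. c r * g r x) = 0" for c
  proof (rule monic_order_independent)
    \<comment> \<open>The factor \<open>Q0\<close> does not change the order, but it makes the combination vanish also where the
      curve passes through the origin of \<open>W\<close> and gives no point of the projective space.\<close>
    show "monic_order (G r * Q0) (N * (\<Sum>p<i. e r p) + r)" if r: "r < q ^ i" for r
    proof -
      have "monic_order (G r * Q0) ((\<Sum>p<i. e r p * (N + q ^ p)) + (i * q - (\<Sum>p<i. e r p)) * 0 + 0)"
        unfolding G_def by (intro monic_order_mult monic_order_prod monic_order_power Q Q0) simp
      moreover have "(\<Sum>p<i. e r p * (N + q ^ p)) = N * (\<Sum>p<i. e r p) + (\<Sum>p<i. e r p * q ^ p)"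
        by (simp add: distrib_left sum.distrib sum_distrib_left mult.commute)
      moreover have "(\<Sum>p<i. e r p * q ^ p) = r"
        unfolding e_def sum_digits using r by simp
      ultimately show ?thesis by simp
    qed
    show "inj_on (\<lambda>r. N * (\<Sum>p<i. e r p) + r) {..<q ^ i}"
    proof (rule inj_onI)
      fix r s assume rs: "r \<in> {..<q ^ i}" "s \<in> {..<q ^ i}"
        "N * (\<Sum>p<i. e r p) + r = N * (\<Sum>p<i. e s p) + s"
      have "q ^ i \<le> N" unfolding N_def using i q by (intro power_increasing) auto
      then have "r < N" "s < N" using rs by auto
      then have "(N * (\<Sum>p<i. e r p) + r) mod N = r" "(N * (\<Sum>p<i. e s p) + s) mod N = s" by simp_all
      then show "r = s" using rs(3) by simp
    qed
    show "(\<Sum>r<q ^ i. c r * poly (G r * Q0) t) = 0" for t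
    proof -
      have "poly (G r * Q0) t = g r (curve t) * f0 (curve t)" for r
        unfolding G_def g_def by (simp add: poly_prod Q(2) f0(2))
      then have eq: "(\<Sum>r<q ^ i. c r * poly (G r * Q0) t) = (\<Sum>r<q ^ i. c r * g r (curve t)) * f0 (curve t)"
        by (simp add: sum_distrib_right mult.assoc)
      show ?thesis
      proof (cases "curve t = 0")
        case True
        interpret f0: Vector_Spaces.linear scaleW "(*)" f0 by (rule f0(1))
        show ?thesis unfolding eq True by (simp add: f0.zero)
      next
        case False
        have "truncate i (\<lambda>j. poly (Y j) t) = (\<lambda>j. poly (Y j) t)"
          by (auto simp: truncate_def Y_def)
        then have "curve t = flag_param i (\<lambda>j. poly (Y j) t)"
          by (simp add: flag_param_def curve_def)
        then have "curve t \<in> \<Union>(P.param_image (flag_param i))"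
          using False W.span_base[of "curve t" "{curve t}"] unfolding P.param_image_def by auto
        with c have "(\<Sum>r<q ^ i. c r * g r (curve t)) = 0" by (rule bspec)
        then show ?thesis unfolding eq by simp
      qed
    qed
  qed
  ultimately show ?thesis unfolding P.hilbert_ge_def by (intro exI[of _ g]) simp
qed

lemma proj_dim_secant: "P.proj_dim (P.zariski closure_of secant_points) = enat secant_dim"
proof (rule antisym[OF proj_dim_secant_le])
  show "enat secant_dim \<le> P.proj_dim (P.zariski closure_of secant_points)"
  proof (rule P.proj_dim_ge[where \<phi> = flag_param and D = "k + 1"])
    show "P.poly_map i (k + 1) (flag_param i)" for i
      using poly_map_secant_param[of i es opposite] by (simp only: flag_param_def[abs_def])
    show "P.param_image (flag_param i) \<subseteq> P.param_image (flag_param (Suc i))" for i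
    proof -
      have "flag_param i y = flag_param (Suc i) (truncate i y)" for y
      proof -
        have "truncate (Suc i) (truncate i y) = truncate i y" by (auto simp: truncate_def)
        then show ?thesis by (simp add: flag_param_def)
      qed
      then show ?thesis unfolding P.param_image_def by (auto 4 3)
    qed
    show "P.param_image (flag_param secant_dim) \<subseteq> P.zariski closure_of secant_points"
      using flag_param_image_subset closure_of_subset[of secant_points P.zariski] secant_points_subset
      by (auto simp: P.topspace_zariski)
  qed (simp_all add: hilbert_ge_flag)
qed

end

section \<open>The expected dimension\<close>

lemma binomial_ge_self:
  assumes "0 < a" "a < l" shows "l \<le> (l choose a)"
  using assms
proof (induction l arbitrary: a)
  case (Suc l)
  then obtain b where b: "a = Suc b" by (cases a) auto
  show ?case
  proof (cases "a = l")
    case True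
    then show ?thesis using binomial_symmetric[of a "Suc l"] by simp
  next
    case False
    then have "l \<le> (l choose a)" "1 \<le> (l choose b)" using Suc b by (auto simp: Suc_le_eq zero_less_binomial)
    then show ?thesis by (simp add: b)
  qed
qed simp

text \<open>
  In Vandermonde's identity \<open>j\<close> counts the elements of a \<open>k\<close>-subset in a fixed block of \<open>k\<close> indices.  The
  values \<open>j = k\<close> and \<open>j = k - 1\<close> account for the tangent space at one point; the values \<open>0\<close> and \<open>1\<close>, which
  are different from these as \<open>k \<ge> 3\<close>, for at least as many subsets.
\<close>

lemma binomial_ge_two_tangent_spaces:
  assumes "3 \<le> k" "k \<le> l"
  shows "2 * (k * l + 1) \<le> (k + l choose k)"
proof -
  let ?f = "\<lambda>j. (k choose j) * (l choose (k - j))"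
  have "l \<le> (l choose (k - 1))" using assms by (intro binomial_ge_self) auto
  then have "k * l \<le> ?f 1" using mult_le_mono2[of l "l choose (k - 1)" k] by simp
  moreover have "1 \<le> ?f 0" using assms by (simp add: Suc_le_eq zero_less_binomial)
  moreover have "?f (k - 1) = k * l"
    using assms binomial_symmetric[of 1 k] by simp
  moreover have "?f k = 1" by simp
  ultimately have "1 + k * l + k * l + 1 \<le> ?f 0 + ?f 1 + ?f (k - 1) + ?f k"
    by (intro add_mono) simp_all
  then have "2 * (k * l + 1) \<le> ?f 0 + ?f 1 + ?f (k - 1) + ?f k" by (simp only: mult_2 add.assoc add.commute add.left_commute)
  also have "\<dots> = (\<Sum>j\<in>{0, 1, k - 1, k}. ?f j)" using assms by simp
  also have "\<dots> \<le> (\<Sum>j\<le>k. ?f j)" using assms by (intro sum_mono2) auto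
  also have "\<dots> = (k + l choose k)" by (rule vandermonde)
  finally show ?thesis .
qed

theorem corollary2p2:
  fixes scaleV :: "'a::{alg_closed_field, field_char_0} \<Rightarrow> 'v::ab_group_add \<Rightarrow> 'v"
    and scaleW :: "'a \<Rightarrow> 'w::ab_group_add \<Rightarrow> 'w"
    and wedge :: "'v list \<Rightarrow> 'w"
    and n k :: nat
  assumes "vector_space scaleV"
    and "vector_space.dim scaleV (UNIV :: 'v set) = n + 1"
    and "exterior_power scaleV scaleW k wedge"
    and "3 \<le> k" and "k \<le> (n + 1) div 2"
  shows "projective_space.proj_dim scaleW
      (projective_space.secant_variety scaleW 2
        (exterior_power.plucker scaleV scaleW wedge ` exterior_power.grassmannian scaleV k))
    = enat (min ((n + 1 choose k) - 1) (2 * k * (n + 1 - k) + 1))"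
proof -
  define l where "l = n + 1 - k"
  have kl: "k \<le> l" "n + 1 = k + l" using assms(5) by (auto simp: l_def)
  interpret V: vector_space scaleV by (rule assms(1))
  obtain B where B: "V.independent B" "UNIV \<subseteq> V.span B" "card B = n + 1"
    using V.basis_exists[of UNIV] assms(2) by metis
  then have "finite B" by (metis Suc_eq_plus1 card.infinite nat.distinct(1))
  then obtain es where es: "set es = B" "distinct es" using finite_distinct_list by blast
  interpret E: exterior_power scaleV scaleW k wedge by (rule assms(3))
  interpret T: transversal_charts scaleV scaleW k wedge es l
    by unfold_locales (use B es kl assms(4) in \<open>auto simp: distinct_card[symmetric]\<close>)
  have "T.P.secant_variety 2 (E.plucker ` E.grassmannian) = T.P.zariski closure_of T.secant_points"
    by (simp add: T.P.secant_variety_def T.secant_points_def)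
  then have "T.P.proj_dim (T.P.secant_variety 2 (E.plucker ` E.grassmannian)) = enat (2 * k * l + 1)"
    by (simp add: T.proj_dim_secant T.secant_dim_def)
  moreover have "min ((n + 1 choose k) - 1) (2 * k * (n + 1 - k) + 1) = 2 * k * l + 1"
    using binomial_ge_two_tangent_spaces[OF assms(4) kl(1)] unfolding kl(2) by (simp add: mult.assoc)
  ultimately show ?thesis by simp
qed

end
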